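(* Let $\mathcal{F}=\{F_1,\dots,F_k\}$ be a finite set of locally Lipschitz, complete vector fields on $\mathbb{R}^n$ such that the origin $0\in\mathbb{R}^n$ is globally asymptotically stable (GAS) under every $F_i\in\mathcal{F}$. If $0$ is GAS under the switched system $$\frac{\mathrm{d}}{\mathrm{d}t}x(t)=F_{\sigma(t)}(x(t))$$ with arbitrary switching, where $t\mapsto\sigma(t)$ ranges over piecewise constant functions with values in $\{1,\dots,k\}$, then all elements of $\mathcal{F}$ belong to the same path-connected component of the space of continuous vector fields on $\mathbb{R}^n$ for which $0$ is GAS.
   Context: Continuous vector fields on $\mathbb{R}^n$ are identified with elements of $C^0(\mathbb{R}^n;\mathbb{R}^n)$, which is endowed with the compact-open topology; the space of continuous vector fields for which $0$ is GAS carries the subspace topology. Thus two vector fields $F,G$ lie in the same path-connected component if and only if there is a continuous $H:[0,1]\times\mathbb{R}^n\to\mathbb{R}^n$ with $H(0,\cdot)=F$, $H(1,\cdot)=G$ and $0$ GAS under $H(s,\cdot)$ for every $s\in[0,1]$. A vector field is complete if it induces a continuous global flow $\mathbb{R}\times\mathbb{R}^n\to\mathbb{R}^n$. For a continuous vector field $G$ on $\mathbb{R}^n$ with $G(0)=0$, the point $0$ is GAS under $G$ if (i) for every open neighbourhood $U_\varepsilon$ of $0$ there is an open neighbourhood $U_\delta\subseteq U_\varepsilon$ of $0$ such that every solution of $\dot x=G(x)$ starting in $U_\delta$ at time $0$ stays in $U_\varepsilon$ for all forward times; and (ii) for every $x_0\in\mathbb{R}^n$, every maximal forward solution with $x(0)=x_0$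 is defined for all $t\geq 0$ and converges to $0$ as $t\to+\infty$. Analogously, $0$ is GAS under the switched system if (i) for every open neighbourhood $U_\varepsilon$ of $0$ there is an open neighbourhood $U_\delta\subseteq U_\varepsilon$ of $0$ such that for every piecewise constant $\sigma:[0,\infty)\to\{1,\dots,k\}$ (finitely many discontinuities on every bounded interval) the solution starting in $U_\delta$ at time $0$ stays in $U_\varepsilon$ for all $t\geq 0$; and (ii) for every such $\sigma$ and every $x_0\in\mathbb{R}^n$ the solution with $x(0)=x_0$ is defined for all $t\geq 0$ and converges to $0$ as $t\to+\infty$. *)

theory Defs
  imports "HOL-Analysis.Analysis"
begin

definition locally_lipschitz :: "(real ^ 'n \<Rightarrow> real ^ 'n) \<Rightarrow> bool" where
  "locally_lipschitz F \<longleftrightarrow> local_lipschitz (UNIV :: real set) UNIV (\<lambda>_. F)"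

definition is_flow_of :: "(real ^ 'n \<Rightarrow> real ^ 'n) \<Rightarrow> (real \<Rightarrow> real ^ 'n \<Rightarrow> real ^ 'n) \<Rightarrow> bool" where
  "is_flow_of F \<phi> \<longleftrightarrow>
     continuous_on UNIV (\<lambda>(t, x). \<phi> t x) \<and>
     (\<forall>x. \<phi> 0 x = x) \<and>
     (\<forall>s t x. \<phi> (s + t) x = \<phi> s (\<phi> t x)) \<and>
     (\<forall>t x. ((\<lambda>s. \<phi> s x) has_vector_derivative F (\<phi> t x)) (at t))"

definition complete_vector_field :: "(real ^ 'n \<Rightarrow> real ^ 'n) \<Rightarrow> bool" where
  "complete_vector_field F \<longleftrightarrow> (\<exists>\<phi>. is_flow_of F \<phi>)"

text \<open>Forward solutions live on the interval from 0 (included) to T (excluded), where T may be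
  infinite; the values of a solution outside this interval are irrelevant.\<close>

definition forward_solution :: "(real ^ 'n \<Rightarrow> real ^ 'n) \<Rightarrow> ereal \<Rightarrow> (real \<Rightarrow> real ^ 'n) \<Rightarrow> bool" where
  "forward_solution G T x \<longleftrightarrow> 0 < T \<and>
     (\<forall>t\<ge>0. ereal t < T \<longrightarrow> (x has_vector_derivative G (x t)) (at t within {0..}))"

text \<open>A solution concept S relates the end point T of the interval of definition to the curve;
  a solution is maximal if it has no proper extension that is again a solution.\<close>

definition maximal_solution ::
  "(ereal \<Rightarrow> (real \<Rightarrow> real ^ 'n) \<Rightarrow> bool) \<Rightarrow> ereal \<Rightarrow> (real \<Rightarrow> real ^ 'n) \<Rightarrow> bool" where
  "maximal_solution S T x \<longleftrightarrow> S T x \<and>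
     \<not> (\<exists>T' y. T < T' \<and> S T' y \<and> (\<forall>t\<ge>0. ereal t < T \<longrightarrow> y t = x t))"

definition GAS :: "(real ^ 'n \<Rightarrow> real ^ 'n) \<Rightarrow> bool" where
  "GAS G \<longleftrightarrow>
     G 0 = 0 \<and>
     (\<forall>U\<^sub>\<epsilon>. open U\<^sub>\<epsilon> \<and> 0 \<in> U\<^sub>\<epsilon> \<longrightarrow>
        (\<exists>U\<^sub>\<delta>. open U\<^sub>\<delta> \<and> 0 \<in> U\<^sub>\<delta> \<and> U\<^sub>\<delta> \<subseteq> U\<^sub>\<epsilon> \<and>
           (\<forall>T x. forward_solution G T x \<and> x 0 \<in> U\<^sub>\<delta> \<longrightarrow>
              (\<forall>t\<ge>0. ereal t < T \<longrightarrow> x t \<in> U\<^sub>\<epsilon>)))) \<and>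
     (\<forall>x\<^sub>0 T x. maximal_solution (forward_solution G) T x \<and> x 0 = x\<^sub>0 \<longrightarrow>
        T = \<infinity> \<and> (x \<longlongrightarrow> 0) at_top)"

text \<open>The type of natural numbers is discrete, so a function into it that is continuous on an
  interval is constant there.\<close>

definition switching_signal :: "nat \<Rightarrow> (real \<Rightarrow> nat) \<Rightarrow> bool" where
  "switching_signal k \<sigma> \<longleftrightarrow>
     (\<forall>t\<ge>0. \<sigma> t \<in> {1..k}) \<and>
     (\<forall>b. finite {t \<in> {0..b}. \<not> continuous (at t within {0..}) \<sigma>})"

text \<open>At the switching instants, a solution is only required to be continuous.\<close>

definition switched_solution ::
  "(nat \<Rightarrow> real ^ 'n \<Rightarrow> real ^ 'n) \<Rightarrow> (real \<Rightarrow> nat) \<Rightarrow> ereal \<Rightarrow> (real \<Rightarrow> real ^ 'n) \<Rightarrow> bool" where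
  "switched_solution F \<sigma> T x \<longleftrightarrow> 0 < T \<and>
     (\<forall>t\<ge>0. ereal t < T \<longrightarrow>
        continuous (at t within {0..}) x \<and>
        (continuous (at t within {0..}) \<sigma> \<longrightarrow>
           (x has_vector_derivative F (\<sigma> t) (x t)) (at t within {0..})))"

definition switched_GAS :: "nat \<Rightarrow> (nat \<Rightarrow> real ^ 'n \<Rightarrow> real ^ 'n) \<Rightarrow> bool" where
  "switched_GAS k F \<longleftrightarrow>
     (\<forall>U\<^sub>\<epsilon>. open U\<^sub>\<epsilon> \<and> 0 \<in> U\<^sub>\<epsilon> \<longrightarrow>
        (\<exists>U\<^sub>\<delta>. open U\<^sub>\<delta> \<and> 0 \<in> U\<^sub>\<delta> \<and> U\<^sub>\<delta> \<subseteq> U\<^sub>\<epsilon> \<and>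
           (\<forall>\<sigma>. switching_signal k \<sigma> \<longrightarrow>
              (\<forall>T x. switched_solution F \<sigma> T x \<and> x 0 \<in> U\<^sub>\<delta> \<longrightarrow>
                 (\<forall>t\<ge>0. ereal t < T \<longrightarrow> x t \<in> U\<^sub>\<epsilon>))))) \<and>
     (\<forall>\<sigma>. switching_signal k \<sigma> \<longrightarrow>
        (\<forall>x\<^sub>0 T x. maximal_solution (switched_solution F \<sigma>) T x \<and> x 0 = x\<^sub>0 \<longrightarrow>
           T = \<infinity> \<and> (x \<longlongrightarrow> 0) at_top))"

definition compact_open_topology :: "('a::topological_space \<Rightarrow> 'b::topological_space) topology" where
  "compact_open_topology = topology_generated_by
     {{f. continuous_on UNIV f \<and> f ` K \<subseteq> U} | K U. compact K \<and> open U}"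

lemma topspace_compact_open_topology:
  "topspace compact_open_topology =
     {f :: 'a::topological_space \<Rightarrow> 'b::topological_space. continuous_on UNIV f}"
proof -
  have "{f :: 'a \<Rightarrow> 'b. continuous_on UNIV f} \<in>
      {{f. continuous_on UNIV f \<and> f ` K \<subseteq> U} | K U. compact K \<and> open U}"
    by (rule CollectI, rule exI[of _ "{}"], rule exI[of _ "{}"]) simp
  then show ?thesis
    unfolding compact_open_topology_def topology_generated_by_topspace by blast
qed

definition GAS_vector_fields :: "(real ^ 'n \<Rightarrow> real ^ 'n) topology" where
  "GAS_vector_fields = subtopology compact_open_topology {G. GAS G}"

end

(*
Write A = F i and B = F j.  Along the straight segment (1 - s) A + s B, finite-time escape is hard to
exclude: the attractivity hypothesis is not uniform in the signal and says nothing about signals whose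
switching instants accumulate, which are the ones that would follow an escaping solution.
The path used is H s x = (1 - c) A x + c B x with the state-dependent weight
c = max 0 (s - (1 - s) |x|), which vanishes outside a bounded set as long as s < 1.  Outside this set
H s is A, whose forward orbits starting in a compact set are uniformly bounded, so solutions of H s
do not escape.

A solution of H s is shadowed by switched solutions: over short time steps, A is followed for the
fraction 1 - c and B for the fraction c of each step.  Working backwards in time from the end point,
where both curves agree, gives stability at once.  For attractivity, suppose that a solution z stays
away from 0.  One signal is built on successive unit intervals, each time with a tolerance so small
that the backward evolution over the previous intervals keeps the error below r; a cluster point of
the resulting initial values then starts a switched solution that stays r-close to z for all times,
and therefore does not converge to 0.
*)
theory Submission
  imports Defs
begin

section \<open>Locally Lipschitz vector fields\<close>

lemma locally_lipschitz_on_compact: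
  assumes "locally_lipschitz F" "compact K"
  obtains L where "L-lipschitz_on K F"
proof -
  have "local_lipschitz {0::real} K (\<lambda>_. F)"
    using assms(1) unfolding locally_lipschitz_def by (rule local_lipschitz_subset) auto
  then obtain L where "\<And>t. t \<in> {0::real} \<Longrightarrow> L-lipschitz_on K F"
    using local_lipschitz_compact_implies_lipschitz[where X=K and T="{0::real}" and f="\<lambda>_. F"] assms(2) by auto
  then show thesis using that by blast
qed

lemma locally_lipschitz_continuous_on:
  assumes "locally_lipschitz F"
  shows "continuous_on S F"
proof -
  have "continuous_on UNIV F"
    using local_lipschitz_continuous_on[OF assms[unfolded locally_lipschitz_def], of 0] by simp
  then show ?thesis by (rule continuous_on_subset) auto
qed

lemma locally_lipschitzI:
  fixes F :: "real ^ 'n \<Rightarrow> real ^ 'n"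
  assumes "\<And>x. \<exists>L. L-lipschitz_on (cball x 1) F"
  shows "locally_lipschitz F"
  unfolding locally_lipschitz_def
proof (rule local_lipschitzI)
  fix t :: real and x :: "real ^ 'n"
  obtain L where "L-lipschitz_on (cball x 1) F" using assms by blast
  then show "\<exists>u>0. \<exists>L. \<forall>t\<in>cball t u \<inter> UNIV. L-lipschitz_on (cball x u \<inter> UNIV) F"
    by (intro exI[of _ 1] conjI exI[of _ L]) auto
qed

section \<open>Uniqueness, local existence and one-step errors of solutions\<close>

text \<open>Gronwall's argument: the squared distance, damped by \<open>exp (- 2 * L * s)\<close>,
  has nonpositive derivative along two solutions in \<open>K\<close>, so it stays zero once it
  vanishes at \<open>a\<close>. Working with the square keeps everything differentiable where the
  curves meet.\<close>

lemma solution_unique: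
  fixes X :: "'a::euclidean_space \<Rightarrow> 'a"
  assumes L: "L-lipschitz_on K X"
    and x: "\<And>t. t \<in> {a..b} \<Longrightarrow> (x has_vector_derivative X (x t)) (at t within {a..b})"
    and y: "\<And>t. t \<in> {a..b} \<Longrightarrow> (y has_vector_derivative X (y t)) (at t within {a..b})"
    and K: "\<And>t. t \<in> {a..b} \<Longrightarrow> x t \<in> K" "\<And>t. t \<in> {a..b} \<Longrightarrow> y t \<in> K"
    and eq: "x a = y a" and t: "t \<in> {a..b}"
  shows "x t = y t"
proof -
  define d where "d s = (x s - y s) \<bullet> (x s - y s)" for s
  define g where "g s = exp (- 2 * L * s) * d s" for s
  define g' where "g' s = exp (- 2 * L * s) * (2 * ((X (x s) - X (y s)) \<bullet> (x s - y s)) - 2 * L * d s)" for s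
  have der: "(g has_real_derivative g' s) (at s within {a..b})" if "s \<in> {a..b}" for s
  proof -
    have w: "((\<lambda>s. x s - y s) has_derivative (\<lambda>h. h *\<^sub>R (X (x s) - X (y s)))) (at s within {a..b})"
      using has_vector_derivative_diff[OF x[OF that] y[OF that]] by (simp add: has_vector_derivative_def)
    have "(d has_derivative (\<lambda>h. (x s - y s) \<bullet> (h *\<^sub>R (X (x s) - X (y s))) + (h *\<^sub>R (X (x s) - X (y s))) \<bullet> (x s - y s))) (at s within {a..b})"
      unfolding d_def by (rule has_derivative_inner[OF w w])
    then have "(d has_real_derivative 2 * ((X (x s) - X (y s)) \<bullet> (x s - y s))) (at s within {a..b})"
      unfolding has_field_derivative_def
      by (rule has_derivative_eq_rhs) (auto simp: fun_eq_iff inner_commute algebra_simps)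
    then show ?thesis unfolding g_def g'_def
      by (auto intro!: derivative_eq_intros simp: algebra_simps)
  qed
  have neg: "g' s \<le> 0" if "s \<in> {a..b}" for s
  proof -
    have "(X (x s) - X (y s)) \<bullet> (x s - y s) \<le> norm (X (x s) - X (y s)) * norm (x s - y s)"
      by (rule norm_cauchy_schwarz)
    also have "\<dots> \<le> (L * norm (x s - y s)) * norm (x s - y s)"
      using lipschitz_onD[OF L K(1)[OF that] K(2)[OF that]]
      by (intro mult_right_mono) (auto simp: dist_norm)
    also have "\<dots> = L * d s" by (simp add: d_def power2_norm_eq_inner[symmetric] power2_eq_square)
    finally show ?thesis unfolding g'_def by (auto intro!: mult_nonneg_nonpos)
  qed
  have at: "a \<le> t" "t \<le> b" using t by auto
  have "g t \<le> g a"
  proof (rule DERIV_nonpos_imp_decreasing_open[OF at(1)])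
    show "\<exists>g'. (g has_real_derivative g') (at s) \<and> g' \<le> 0" if "a < s" "s < t" for s
      using der[of s] neg[of s] that at by (auto simp: at_within_Icc_at intro!: exI[of _ "g' s"])
    have "continuous_on {a..b} g" using der by (rule DERIV_continuous_on)
    then show "continuous_on {a..t} g" by (rule continuous_on_subset) (use at in auto)
  qed
  also have "\<dots> = 0" by (simp add: g_def d_def eq)
  finally have "d t \<le> 0" by (simp add: g_def mult_le_0_iff not_less)
  then show ?thesis unfolding d_def by (metis inner_ge_zero inner_eq_zero_iff order_antisym right_minus_eq)
qed

text \<open>Picard iteration as a contraction with factor \<open>h * L\<close> on bounded continuous
  functions on the whole line. To have the operator defined on all of them, \<open>X\<close> is
  precomposed with the projection \<open>c\<close> onto the ball and time is clamped to
  \<open>{0..h}\<close> by \<open>cl\<close>. Since \<open>h * N \<le> r\<close>, the fixed point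
  stays in the ball, where the modified field is \<open>X\<close>.\<close>

lemma picard_local_existence:
  fixes X :: "'a::euclidean_space \<Rightarrow> 'a"
  assumes L: "L-lipschitz_on (cball x0 r) X" and N: "\<And>x. x \<in> cball x0 r \<Longrightarrow> norm (X x) \<le> N"
    and r: "0 \<le> r" and h: "0 \<le> h" "h * N \<le> r" "h * L < 1"
  obtains x where "x 0 = x0" "\<And>t. t \<in> {0..h} \<Longrightarrow> (x has_vector_derivative X (x t)) (at t within {0..h})"
proof -
  define c where "c = closest_point (cball x0 r)"
  have c_in: "c y \<in> cball x0 r" for y
    unfolding c_def using r by (intro closest_point_in_set) auto
  have c_id: "c y = y" if "y \<in> cball x0 r" for y
    unfolding c_def using that by (simp add: closest_point_self)
  have c_lip: "dist (c y) (c z) \<le> dist y z" for y z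
    unfolding c_def using r by (intro closest_point_lipschitz) auto
  define Y where "Y y = X (c y)" for y
  have L0: "0 \<le> L" using L by (rule lipschitz_on_nonneg)
  have N0: "0 \<le> N" using N[of x0] r by (auto intro: order_trans[OF norm_ge_zero])
  have Ylip: "dist (Y y) (Y z) \<le> L * dist y z" for y z
    unfolding Y_def using lipschitz_onD[OF L c_in c_in, of y z] mult_left_mono[OF c_lip[of y z] L0]
    by linarith
  have YN: "norm (Y y) \<le> N" for y unfolding Y_def by (intro N c_in)
  have Ycont: "continuous_on S (\<lambda>s. Y (f s))" if "continuous_on S f" for f :: "real \<Rightarrow> 'a" and S
  proof -
    have "L-lipschitz_on UNIV Y" using Ylip L0 by (intro lipschitz_onI) auto
    then have "continuous_on UNIV Y" by (rule lipschitz_on_continuous_on)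
    then show ?thesis using that by (rule continuous_on_compose2) auto
  qed
  define J where "J f t = x0 + integral {0..t} (\<lambda>s. Y (f s))" for f :: "real \<Rightarrow> 'a" and t
  define cl where "cl t = max 0 (min h t)" for t :: real
  have cl: "cl t \<in> {0..h}" "t \<in> {0..h} \<Longrightarrow> cl t = t" for t using h(1) by (auto simp: cl_def)
  have Jder: "((J f) has_vector_derivative Y (f t)) (at t within {0..h})"
    if "t \<in> {0..h}" "continuous_on {0..h} f" for f t
    unfolding J_def using integral_has_vector_derivative[OF Ycont[OF that(2)] that(1)]
    by (auto intro!: derivative_eq_intros)
  have Jcont: "continuous_on {0..h} (J f)" if "continuous_on {0..h} f" for f
    using Jder[OF _ that] by (rule continuous_on_vector_derivative)
  have bc: "(\<lambda>t. J (apply_bcontfun f) (cl t)) \<in> bcontfun" for f :: "real \<Rightarrow>\<^sub>C 'a"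
  proof -
    have 1: "continuous_on {0..h} (J f)" by (intro Jcont) simp
    have "continuous_on UNIV (\<lambda>t. J f (cl t))"
      by (rule continuous_on_compose2[OF 1, of UNIV cl])
         (use cl in \<open>auto simp: cl_def intro!: continuous_intros\<close>)
    moreover have "bounded (J f ` {0..h})"
      using 1 by (intro compact_imp_bounded compact_continuous_image) auto
    then have "bounded (range (\<lambda>t. J f (cl t)))"
      by (rule bounded_subset) (use cl in auto)
    ultimately show ?thesis by (simp add: bcontfun_def)
  qed
  define P where "P f = Bcontfun (\<lambda>t. J (apply_bcontfun f) (cl t))" for f
  have P: "apply_bcontfun (P f) t = J f (cl t)" for f t
    unfolding P_def by (simp add: Bcontfun_inverse bc)
  have intY: "(\<lambda>s. Y (apply_bcontfun f s)) integrable_on {0..t}" for f :: "real \<Rightarrow>\<^sub>C 'a" and t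
    by (intro integrable_continuous_real Ycont) simp
  have "dist (P f) (P g) \<le> (h * L) * dist f g" for f g
  proof (rule dist_bound)
    fix t
    have "dist (P f t) (P g t) = norm (integral {0..cl t} (\<lambda>s. Y (f s) - Y (g s)))"
      unfolding P J_def dist_norm by (simp add: integral_diff intY)
    also have "\<dots> \<le> (L * dist f g) * (cl t - 0)"
    proof (rule integral_bound)
      show "0 \<le> cl t" using cl(1)[of t] by simp
      show "continuous_on {0..cl t} (\<lambda>s. Y (f s) - Y (g s))" by (intro continuous_intros Ycont) simp_all
      show "norm (Y (f s) - Y (g s)) \<le> L * dist f g" for s
        using Ylip[of "f s" "g s"] mult_left_mono[OF dist_bounded[of f s g] L0] by (simp add: dist_norm)
    qed
    also have "\<dots> \<le> (L * dist f g) * h"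
      using cl(1)[of t] L0 by (intro mult_left_mono) auto
    finally show "dist (P f t) (P g t) \<le> (h * L) * dist f g" by (simp add: algebra_simps)
  qed
  moreover have "0 \<le> h * L" using h(1) L0 by simp
  ultimately obtain f where f: "P f = f"
    using banach_fix_type[of "h * L" P] h(3) by auto
  have feq: "f t = J f t" if "t \<in> {0..h}" for t
    using P[of f t] cl(2)[OF that] unfolding f by simp
  have der: "(apply_bcontfun f has_vector_derivative Y (f t)) (at t within {0..h})" if "t \<in> {0..h}" for t
    by (rule has_vector_derivative_transform[OF that _ Jder[OF that]]) (simp_all add: feq)
  have "f t \<in> cball x0 r" if "t \<in> {0..h}" for t
  proof -
    have "norm (integral {0..t} (\<lambda>s. Y (f s))) \<le> N * (t - 0)"
      using that YN by (intro integral_bound Ycont) auto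
    also have "\<dots> \<le> N * h" using that N0 by (intro mult_left_mono) auto
    finally show ?thesis using h(2) by (simp add: feq[OF that] J_def dist_norm mult.commute)
  qed
  then have "(apply_bcontfun f has_vector_derivative X (f t)) (at t within {0..h})" if "t \<in> {0..h}" for t
    using der[OF that] that by (simp add: Y_def c_id)
  moreover have "f 0 = x0" using feq[of 0] h(1) by (simp add: J_def)
  ultimately show thesis using that by blast
qed

text \<open>The mean value inequality, used twice: speed at most \<open>M\<close> gives the
  displacement bound, and this bound with the Lipschitz constant shows that the velocity changes by
  at most \<open>L * (M * h)\<close> during the step, whence a second-order error for the Euler
  step.\<close>

lemma euler_step_error:
  fixes X :: "'a::real_normed_vector \<Rightarrow> 'a"
  assumes w: "\<And>t. t \<in> {0..h} \<Longrightarrow> (w has_vector_derivative X (w t)) (at t within {0..h})"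
    and K: "\<And>t. t \<in> {0..h} \<Longrightarrow> w t \<in> K"
    and L: "L-lipschitz_on K X" and M: "\<And>x. x \<in> K \<Longrightarrow> norm (X x) \<le> M" and h: "0 \<le> h"
  shows "\<And>t. t \<in> {0..h} \<Longrightarrow> norm (w t - w 0) \<le> M * h"
    and "norm (w h - w 0 - h *\<^sub>R X (w 0)) \<le> L * M * h\<^sup>2"
proof -
  have "norm (X (w 0)) \<le> M" using h by (intro M K) simp
  then have M0: "0 \<le> M" using norm_ge_zero order_trans by blast
  have L0: "0 \<le> L" using L by (rule lipschitz_on_nonneg)
  show 1: "norm (w t - w 0) \<le> M * h" if t: "t \<in> {0..h}" for t
  proof -
    have "norm (w t - w 0) \<le> M * norm (t - 0)"
    proof (rule differentiable_bound[of "{0..h}" w "\<lambda>t h. h *\<^sub>R X (w t)"])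
      show "onorm (\<lambda>h. h *\<^sub>R X (w s)) \<le> M" if "s \<in> {0..h}" for s
        using M[OF K[OF that]] by (intro onorm_le) (simp add: mult.commute[of M] mult_left_mono)
    qed (use w t h in \<open>auto simp: has_vector_derivative_def\<close>)
    also have "\<dots> \<le> M * h" using t M0 by (intro mult_left_mono) auto
    finally show ?thesis .
  qed
  have "norm (w h - w 0 - (h - 0) *\<^sub>R X (w 0)) \<le> norm (h - 0) * (L * (M * h))"
  proof (rule vector_differentiable_bound_linearization)
    show "norm (X (w t) - X (w 0)) \<le> L * (M * h)" if "t \<in> {0..h}" for t
    proof -
      have "norm (X (w t) - X (w 0)) \<le> L * norm (w t - w 0)"
        using lipschitz_onD[OF L K[OF that] K[of 0]] h by (simp add: dist_norm)
      also have "\<dots> \<le> L * (M * h)" using 1[OF that] L0 by (rule mult_left_mono)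
      finally show ?thesis .
    qed
  qed (use w h in \<open>auto simp: closed_segment_eq_real_ivl\<close>)
  then show "norm (w h - w 0 - h *\<^sub>R X (w 0)) \<le> L * M * h\<^sup>2"
    using h by (simp add: power2_eq_square algebra_simps)
qed

section \<open>Flows of complete vector fields\<close>

lemma is_flow_ofD:
  assumes "is_flow_of F \<phi>"
  shows "continuous_on UNIV (\<lambda>(t, x). \<phi> t x)" "\<phi> 0 x = x" "\<phi> (s + t) x = \<phi> s (\<phi> t x)"
    "((\<lambda>s. \<phi> s x) has_vector_derivative F (\<phi> t x)) (at t)"
proof -
  note flow = assms[unfolded is_flow_of_def]
  show "continuous_on UNIV (\<lambda>(t, x). \<phi> t x)" by (rule flow[THEN conjunct1])
  show "\<phi> 0 x = x" by (rule flow[THEN conjunct2, THEN conjunct1, THEN spec])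
  show "\<phi> (s + t) x = \<phi> s (\<phi> t x)"
    by (rule flow[THEN conjunct2, THEN conjunct2, THEN conjunct1, THEN spec, THEN spec, THEN spec])
  show "((\<lambda>s. \<phi> s x) has_vector_derivative F (\<phi> t x)) (at t)"
    by (rule flow[THEN conjunct2, THEN conjunct2, THEN conjunct2, THEN spec, THEN spec])
qed

lemma flow_continuous_on:
  assumes "is_flow_of F \<phi>" "continuous_on S f" "continuous_on S g"
  shows "continuous_on S (\<lambda>s. \<phi> (f s) (g s))"
proof -
  have "continuous_on S (\<lambda>s. (f s, g s))" by (rule continuous_on_Pair[OF assms(2,3)])
  then have "continuous_on S (\<lambda>s. case (f s, g s) of (t, x) \<Rightarrow> \<phi> t x)"
    by (rule continuous_on_compose2[OF is_flow_ofD(1)[OF assms(1)]]) auto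
  then show ?thesis by simp
qed

lemma flow_shift_deriv:
  assumes "is_flow_of F \<phi>"
  shows "((\<lambda>s. \<phi> (s - a) x) has_vector_derivative F (\<phi> (t - a) x)) (at t within S)"
    and "((\<lambda>s. \<phi> (a - s) x) has_vector_derivative - F (\<phi> (a - t) x)) (at t within S)"
proof -
  have "((\<lambda>s. s - a) has_vector_derivative 1) (at t)"
    by (simp flip: has_real_derivative_iff_has_vector_derivative) (auto intro!: derivative_eq_intros)
  from has_vector_derivative_at_within[OF vector_diff_chain_at[OF this is_flow_ofD(4)[OF assms]]]
  show "((\<lambda>s. \<phi> (s - a) x) has_vector_derivative F (\<phi> (t - a) x)) (at t within S)"
    unfolding o_def by simp
  have "((\<lambda>s. a - s) has_vector_derivative - 1) (at t)"
    by (simp flip: has_real_derivative_iff_has_vector_derivative) (auto intro!: derivative_eq_intros)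
  from has_vector_derivative_at_within[OF vector_diff_chain_at[OF this is_flow_ofD(4)[OF assms]]]
  show "((\<lambda>s. \<phi> (a - s) x) has_vector_derivative - F (\<phi> (a - t) x)) (at t within S)"
    unfolding o_def by simp
qed

section \<open>Piecewise constant switching\<close>

text \<open>One-sided conditions at a single instant, so that they survive concatenation; on a compact
  interval they leave room for only finitely many switching instants.\<close>

definition follows_right ::
  "(nat \<Rightarrow> real ^ 'n \<Rightarrow> real ^ 'n) \<Rightarrow> (real \<Rightarrow> nat) \<Rightarrow> (real \<Rightarrow> real ^ 'n) \<Rightarrow> real \<Rightarrow> bool" where
  "follows_right F \<sigma> x t \<longleftrightarrow> (\<forall>\<^sub>F u in at_right t. \<sigma> u = \<sigma> t) \<and>
     (x has_vector_derivative F (\<sigma> t) (x t)) (at_right t)"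

definition follows_left ::
  "(nat \<Rightarrow> real ^ 'n \<Rightarrow> real ^ 'n) \<Rightarrow> (real \<Rightarrow> nat) \<Rightarrow> (real \<Rightarrow> real ^ 'n) \<Rightarrow> real \<Rightarrow> bool" where
  "follows_left F \<sigma> x t \<longleftrightarrow> (\<exists>c. (\<forall>\<^sub>F u in at_left t. \<sigma> u = c) \<and>
     (x has_vector_derivative F c (x t)) (at_left t))"

lemma follows_right_cong:
  assumes "t < b" "\<And>u. u \<in> {t..<b} \<Longrightarrow> \<sigma> u = \<tau> u" "\<And>u. u \<in> {t..<b} \<Longrightarrow> x u = y u"
  shows "follows_right F \<sigma> x t \<longleftrightarrow> follows_right F \<tau> y t"
proof -
  have ev: "\<forall>\<^sub>F u in at_right t. u \<in> {t..<b}"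
    using assms(1) by (auto simp: eventually_at_right_field intro!: exI[of _ b])
  have \<sigma>: "(\<forall>\<^sub>F u in at_right t. \<sigma> u = \<sigma> t) \<longleftrightarrow> (\<forall>\<^sub>F u in at_right t. \<tau> u = \<tau> t)"
    using assms by (intro eventually_subst eventually_mono[OF ev]) auto
  have "\<forall>\<^sub>F u in nhds t. u \<in> {t<..} \<longrightarrow> x u = y u"
    using ev assms(1) by (auto simp: eventually_at_filter elim!: eventually_mono intro: assms(3))
  then have "(x has_vector_derivative F (\<sigma> t) (x t)) (at_right t) \<longleftrightarrow> (y has_vector_derivative F (\<sigma> t) (x t)) (at_right t)"
    by (rule has_vector_derivative_cong_ev) (use assms in auto)
  then show ?thesis using \<sigma> assms by (simp add: follows_right_def)
qed

lemma follows_left_cong: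
  assumes "a < t" "\<And>u. u \<in> {a<..<t} \<Longrightarrow> \<sigma> u = \<tau> u" "\<And>u. u \<in> {a<..t} \<Longrightarrow> x u = y u"
  shows "follows_left F \<sigma> x t \<longleftrightarrow> follows_left F \<tau> y t"
proof -
  have ev: "\<forall>\<^sub>F u in at_left t. u \<in> {a<..<t}"
    using assms(1) by (auto simp: eventually_at_left_field intro!: exI[of _ a])
  have \<sigma>: "(\<forall>\<^sub>F u in at_left t. \<sigma> u = c) \<longleftrightarrow> (\<forall>\<^sub>F u in at_left t. \<tau> u = c)" for c
    using assms by (intro eventually_subst eventually_mono[OF ev]) auto
  have "\<forall>\<^sub>F u in nhds t. u \<in> {..<t} \<longrightarrow> x u = y u"
    using ev assms(1) by (auto simp: eventually_at_filter elim!: eventually_mono intro: assms(3))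
  then have "(x has_vector_derivative F c (x t)) (at_left t) \<longleftrightarrow> (y has_vector_derivative F c (x t)) (at_left t)" for c
    by (rule has_vector_derivative_cong_ev) (use assms in auto)
  then show ?thesis using \<sigma> assms by (simp add: follows_left_def)
qed

lemma has_vector_derivative_from_sides:
  fixes x :: "real \<Rightarrow> 'a::real_normed_vector"
  assumes "(x has_vector_derivative d) (at_left t)" "(x has_vector_derivative d) (at_right t)"
  shows "(x has_vector_derivative d) (at t)"
proof -
  have "(x has_vector_derivative d) (at t within {..<t} \<union> {t<..})"
    using assms unfolding has_vector_derivative_def has_derivative_within
    by (auto simp: at_within_union filterlim_sup)
  moreover have "at t within {..<t} \<union> {t<..} = at t"
    by (simp add: at_eq_sup_left_right at_within_union)
  ultimately show ?thesis by simp
qed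

lemma at_within_nonneg:
  fixes t :: real
  assumes "0 \<le> t"
  shows "at t within {0..} = (if t = 0 then at_right 0 else at t)"
proof (cases "t = 0")
  case True
  have "{0..} - {0::real} = {0<..} - {0}" by auto
  then have "at (0::real) within {0..} = at 0 within {0<..}" by (simp add: at_within_def)
  then show ?thesis using True by simp
next
  case False
  then have "t \<in> interior {0..}" using assms by simp
  from at_within_interior[OF this] show ?thesis using False by simp
qed

text \<open>Turns the one-sided conditions into the official notions. Discontinuities cannot
  accumulate at any \<open>l\<close> in \<open>{0..b}\<close>, because the signal is constant just
  to the right and just to the left of \<open>l\<close>. The conditions on the signal range over all
  times, also those beyond \<open>T\<close>, because a switching signal lives on the whole
  half-line.\<close>

lemma switched_solutionI:
  assumes \<sigma>: "\<And>t. 0 \<le> t \<Longrightarrow> \<sigma> t \<in> {1..k}"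
    and ev: "\<And>t. 0 \<le> t \<Longrightarrow> \<forall>\<^sub>F u in at_right t. \<sigma> u = \<sigma> t"
      "\<And>t. 0 < t \<Longrightarrow> \<exists>c. \<forall>\<^sub>F u in at_left t. \<sigma> u = c"
    and right: "\<And>t. 0 \<le> t \<Longrightarrow> ereal t < T \<Longrightarrow> follows_right F \<sigma> x t"
    and left: "\<And>t. 0 < t \<Longrightarrow> ereal t < T \<Longrightarrow> follows_left F \<sigma> x t"
    and T: "0 < T"
  shows "switching_signal k \<sigma>" "switched_solution F \<sigma> T x"
proof -
  show "switching_signal k \<sigma>" unfolding switching_signal_def
  proof (intro conjI allI impI \<sigma>)
    fix b :: real
    let ?D = "{t \<in> {0..b}. \<not> continuous (at t within {0..}) \<sigma>}"
    show "finite ?D"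
    proof (rule ccontr)
      assume "infinite ?D"
      then obtain l where l: "l \<in> {0..b}" "l islimpt ?D"
        using compact_eq_Bolzano_Weierstrass[of "{0..b}"] by auto
      have cont_iso: "continuous (at u within {0..}) \<sigma>" if "open S" "u \<in> S" "\<And>v. v \<in> S \<Longrightarrow> 0 \<le> v \<Longrightarrow> \<sigma> v = c" "0 \<le> u" for u S c
      proof -
        have "\<forall>\<^sub>F v in at u within {0..}. \<sigma> v = \<sigma> u"
          using that by (auto simp: eventually_at_topological intro!: exI[of _ S])
        then show ?thesis unfolding continuous_within by (rule tendsto_eventually)
      qed
      obtain r where r: "l < r" "\<And>u. l < u \<Longrightarrow> u < r \<Longrightarrow> \<sigma> u = \<sigma> l"
        using ev(1)[of l] l(1) by (auto simp: eventually_at_right_field)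
      \<comment> \<open>Constancy on the left is expressed by comparing two nonnegative points, so
        that it holds vacuously at \<open>l = 0\<close>.\<close>
      obtain q where q: "q < l" "\<And>u v. q < u \<Longrightarrow> u < l \<Longrightarrow> 0 \<le> u \<Longrightarrow> q < v \<Longrightarrow> v < l \<Longrightarrow> 0 \<le> v \<Longrightarrow> \<sigma> u = \<sigma> v"
      proof (cases "l = 0")
        case True
        show ?thesis by (rule that[of "-1"]) (use True in auto)
      next
        case False
        then obtain c p where "p < l" "\<And>u. p < u \<Longrightarrow> u < l \<Longrightarrow> \<sigma> u = c"
          using ev(2)[of l] l(1) by (auto simp: eventually_at_left_field)
        then show ?thesis by (intro that[of p]) auto
      qed
      have "open {q<..<r}" "l \<in> {q<..<r}" using q r by auto
      then obtain u where u: "u \<in> ?D" "u \<in> {q<..<r}" "u \<noteq> l"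
        using l(2) unfolding islimpt_def by metis
      have "continuous (at u within {0..}) \<sigma>"
      proof (cases "u < l")
        case True
        show ?thesis by (rule cont_iso[of "{q<..<l}" _ "\<sigma> u"]) (use True u q(2) in auto)
      next
        case False
        show ?thesis by (rule cont_iso[of "{l<..<r}" _ "\<sigma> l"]) (use False u r(2) in auto)
      qed
      then show False using u by simp
    qed
  qed
  show "switched_solution F \<sigma> T x" unfolding switched_solution_def
  proof (intro conjI allI impI T)
    fix t :: real assume t: "0 \<le> t" "ereal t < T"
    have r: "(x has_vector_derivative F (\<sigma> t) (x t)) (at_right t)" "\<forall>\<^sub>F u in at_right t. \<sigma> u = \<sigma> t"
      using right[OF t] by (auto simp: follows_right_def)
    have cr: "(x \<longlongrightarrow> x t) (at_right t)"
      using has_vector_derivative_continuous[OF r(1)] by (simp add: continuous_within)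
    show "continuous (at t within {0..}) x"
    proof (cases "t = 0")
      case True
      then show ?thesis using cr by (simp add: at_within_nonneg continuous_within)
    next
      case False
      then obtain c where "(x has_vector_derivative F c (x t)) (at_left t)"
        using left[of t] t by (auto simp: follows_left_def)
      from has_vector_derivative_continuous[OF this] have "(x \<longlongrightarrow> x t) (at_left t)"
        by (simp add: continuous_within)
      then have "(x \<longlongrightarrow> x t) (at t)" using cr by (simp add: filterlim_split_at)
      then show ?thesis using False t by (simp add: at_within_nonneg continuous_within)
    qed
    assume c: "continuous (at t within {0..}) \<sigma>"
    show "(x has_vector_derivative F (\<sigma> t) (x t)) (at t within {0..})"
    proof (cases "t = 0")
      case True
      then show ?thesis using r(1) by (simp add: at_within_nonneg)
    next
      case False
      then obtain m where m: "(x has_vector_derivative F m (x t)) (at_left t)" "\<forall>\<^sub>F u in at_left t. \<sigma> u = m"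
        using left[of t] t by (auto simp: follows_left_def)
      \<comment> \<open>Continuity into a discrete type means local constancy. This forces the
        left-hand index \<open>m\<close> to be \<open>\<sigma> t\<close>, so both one-sided
        derivatives coincide.\<close>
      have "\<forall>\<^sub>F u in at t. \<sigma> u = \<sigma> t"
        using c t False tendsto_discrete[of \<sigma> "\<sigma> t" "at t"]
        by (simp add: at_within_nonneg continuous_within)
      then have "\<forall>\<^sub>F u in at_left t. \<sigma> u = \<sigma> t" by (simp add: eventually_at_split)
      with m(2) have "\<forall>\<^sub>F u in at_left t. m = \<sigma> t" by eventually_elim simp
      then have "m = \<sigma> t" by simp
      then have "(x has_vector_derivative F (\<sigma> t) (x t)) (at t)"
        using m(1) r(1) by (intro has_vector_derivative_from_sides) simp_all
      then show ?thesis using False t by (simp add: at_within_nonneg)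
    qed
  qed
qed

section \<open>Transition maps of the switched system\<close>

text \<open>\<open>E t\<close> is the transition map from time \<open>a\<close> to time
  \<open>t\<close> under the signal \<open>\<sigma>\<close>, and \<open>I\<close> is a continuous
  right inverse of \<open>E b\<close>, which recovers an initial value from a prescribed end point.
  The right inverse is what makes constructions backwards in time possible; its continuity controls
  how the whole curve depends on the end point.\<close>

definition evolution ::
  "nat set \<Rightarrow> (nat \<Rightarrow> real ^ 'n \<Rightarrow> real ^ 'n) \<Rightarrow> real \<Rightarrow> real \<Rightarrow> (real \<Rightarrow> nat) \<Rightarrow>
     (real \<Rightarrow> real ^ 'n \<Rightarrow> real ^ 'n) \<Rightarrow> (real ^ 'n \<Rightarrow> real ^ 'n) \<Rightarrow> bool" where
  "evolution C F a b \<sigma> E I \<longleftrightarrow> a \<le> b \<and> range \<sigma> \<subseteq> C \<and>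
     continuous_on ({a..b} \<times> UNIV) (\<lambda>(t, x). E t x) \<and> (\<forall>x. E a x = x) \<and>
     continuous_on UNIV I \<and> (\<forall>y. E b (I y) = y) \<and>
     (\<forall>x. \<forall>t\<in>{a..<b}. follows_right F \<sigma> (\<lambda>s. E s x) t) \<and>
     (\<forall>x. \<forall>t\<in>{a<..b}. follows_left F \<sigma> (\<lambda>s. E s x) t)"

text \<open>Completeness enters here: the flow run backwards from \<open>b\<close> to
  \<open>a\<close> serves as the right inverse.\<close>

lemma evolution_flow:
  assumes "is_flow_of (F c) \<phi>" "c \<in> C" "a \<le> b"
  shows "evolution C F a b (\<lambda>_. c) (\<lambda>t. \<phi> (t - a)) (\<phi> (a - b))"
  unfolding evolution_def
proof (intro conjI allI ballI)
  show "continuous_on ({a..b} \<times> UNIV) (\<lambda>(t, x). \<phi> (t - a) x)"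
    unfolding split_def by (intro flow_continuous_on[OF assms(1)] continuous_intros)
  show "continuous_on UNIV (\<phi> (a - b))"
    by (intro flow_continuous_on[OF assms(1)] continuous_intros)
  show "\<phi> (b - a) (\<phi> (a - b) y) = y" for y
    using is_flow_ofD(3)[OF assms(1), of "b - a" "a - b" y] is_flow_ofD(2)[OF assms(1)] by simp
  show "\<phi> (a - a) x = x" for x using is_flow_ofD(2)[OF assms(1)] by simp
  show "follows_right F (\<lambda>_. c) (\<lambda>s. \<phi> (s - a) x) t" for x t
    unfolding follows_right_def using flow_shift_deriv(1)[OF assms(1)] by simp
  show "follows_left F (\<lambda>_. c) (\<lambda>s. \<phi> (s - a) x) t" for x t
    unfolding follows_left_def using flow_shift_deriv(1)[OF assms(1)] by (intro exI[of _ c]) simp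
qed (use assms in auto)

text \<open>At the junction \<open>b\<close> the left-hand condition concerns only the first piece
  and the right-hand one only the second, so no compatibility of the signals is needed. The signal
  takes the value of \<open>\<tau>\<close> at \<open>b\<close>, as the right-hand condition demands;
  the curves agree there because \<open>E' b\<close> is the identity. The inverse runs through the
  pieces in reverse order.\<close>

lemma evolution_concat:
  fixes F :: "nat \<Rightarrow> real ^ 'n \<Rightarrow> real ^ 'n"
  assumes 1: "evolution C F a b \<sigma> E I" and 2: "evolution C F b c \<tau> E' I'"
  shows "evolution C F a c (\<lambda>t. if t < b then \<sigma> t else \<tau> t)
    (\<lambda>t x. if t \<le> b then E t x else E' t (E b x)) (I \<circ> I')"
    (is "evolution C F a c ?\<sigma> ?E _")
proof -
  note A = 1[unfolded evolution_def] and B = 2[unfolded evolution_def]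
  have ab: "a \<le> b" "b \<le> c" using A B by blast+
  have inv: "E a x = x" "E b (I x) = x" "E' b x = x" "E' c (I' x) = x" for x using A B by blast+
  have R: "t \<in> {a..<b} \<Longrightarrow> follows_right F \<sigma> (\<lambda>s. E s x) t"
    "t \<in> {b..<c} \<Longrightarrow> follows_right F \<tau> (\<lambda>s. E' s x) t" for t x using A B by blast+
  have L: "t \<in> {a<..b} \<Longrightarrow> follows_left F \<sigma> (\<lambda>s. E s x) t"
    "t \<in> {b<..c} \<Longrightarrow> follows_left F \<tau> (\<lambda>s. E' s x) t" for t x using A B by blast+
  show ?thesis unfolding evolution_def
  proof (intro conjI allI ballI)
    show "a \<le> c" using ab by simp
    show "range ?\<sigma> \<subseteq> C" using A B by auto
    have "continuous_on UNIV (\<lambda>x :: real^'n. (b, x))" by (intro continuous_intros)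
    then have "continuous_on UNIV (\<lambda>x. case (b, x) of (t, x) \<Rightarrow> E t x)"
      by (rule continuous_on_compose2[of "{a..b} \<times> UNIV", rotated]) (use A in auto)
    then have Eb: "continuous_on UNIV (E b)" by simp
    have g: "continuous_on ({b..c} \<times> UNIV) (\<lambda>p. (fst p, E b (snd p)))"
      by (intro continuous_intros continuous_on_compose2[OF Eb]) auto
    have E2: "continuous_on ({b..c} \<times> UNIV) (\<lambda>(t, x). E' t (E b x))"
    proof -
      have "continuous_on ({b..c} \<times> UNIV) (\<lambda>p. (\<lambda>(t, x). E' t x) (fst p, E b (snd p)))"
        by (rule continuous_on_compose2[OF _ g, of "{b..c} \<times> UNIV"]) (use B in auto)
      then show ?thesis by (simp add: split_def)
    qed
    have "continuous_on ({a..b} \<times> UNIV \<union> {b..c} \<times> UNIV)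
       (\<lambda>p. if fst p \<le> b then (\<lambda>(t, x). E t x) p else (\<lambda>(t, x). E' t (E b x)) p)"
      by (rule continuous_on_If) (use A B E2 in \<open>auto simp: closed_Times\<close>)
    moreover have "{a..b} \<times> UNIV \<union> {b..c} \<times> UNIV = {a..c} \<times> (UNIV :: (real^'n) set)" using ab by auto
    moreover have "(\<lambda>p. if fst p \<le> b then (\<lambda>(t, x). E t x) p else (\<lambda>(t, x). E' t (E b x)) p) = (\<lambda>(t, x). ?E t x)"
      by (auto simp: fun_eq_iff)
    ultimately show "continuous_on ({a..c} \<times> UNIV) (\<lambda>(t, x). ?E t x)" by (simp only:)
    show "?E a x = x" for x using ab inv by simp
    show "continuous_on UNIV (I \<circ> I')"
      by (rule continuous_on_compose) (use A B in \<open>auto intro: continuous_on_subset\<close>)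
    show "?E c ((I \<circ> I') y) = y" for y using ab inv by (cases "c \<le> b") (simp_all add: order_antisym)
    fix x t
    show "follows_right F ?\<sigma> (\<lambda>s. ?E s x) t" if t: "t \<in> {a..<c}"
    proof (cases "t < b")
      case True
      have "follows_right F \<sigma> (\<lambda>s. E s x) t" using t True by (intro R L) auto
      then show ?thesis by (subst follows_right_cong[OF True, of _ \<sigma> _ "\<lambda>s. E s x"]) auto
    next
      case False
      have "?E u x = E' u (E b x)" if "u \<in> {t..<c}" for u
      proof (cases "u \<le> b")
        case True
        then have "u = b" using that False by simp
        then show ?thesis by (simp add: inv)
      qed simp
      moreover have "follows_right F \<tau> (\<lambda>s. E' s (E b x)) t" using t False by (intro R) auto
      moreover have "t < c" using t by simp
      ultimately show ?thesis
        by (subst follows_right_cong[of t c _ \<tau> _ "\<lambda>s. E' s (E b x)"]) (use False in auto)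
    qed
    show "follows_left F ?\<sigma> (\<lambda>s. ?E s x) t" if t: "t \<in> {a<..c}"
    proof (cases "t \<le> b")
      case True
      have "follows_left F \<sigma> (\<lambda>s. E s x) t" using t True by (intro R L) auto
      moreover have "a < t" using t by simp
      ultimately show ?thesis using True by (subst follows_left_cong[of a t _ \<sigma> _ "\<lambda>s. E s x"]) auto
    next
      case False
      have "follows_left F \<tau> (\<lambda>s. E' s (E b x)) t" using t False by (intro R L) auto
      then show ?thesis
        by (subst follows_left_cong[of b t _ \<tau> _ "\<lambda>s. E' s (E b x)"]) (use False in auto)
    qed
  qed
qed

section \<open>Shadowing of convex combinations\<close>

text \<open>One splitting step, backwards from \<open>y\<close>: follow \<open>F j\<close> for the
  time \<open>\<mu> * h\<close>, then \<open>F i\<close> for the remaining time. To first order this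
  is a backward Euler step for the combination of the two fields with the weight frozen at
  \<open>z t\<close>, so the distance to \<open>z\<close> grows by the factor
  \<open>1 + L * h\<close> and a second-order term only.\<close>

lemma backward_step:
  fixes F :: "nat \<Rightarrow> real ^ 'n \<Rightarrow> real ^ 'n"
  assumes \<phi>: "is_flow_of (F i) \<phi>" "i \<in> C" and \<psi>: "is_flow_of (F j) \<psi>" "j \<in> C"
    and L: "L-lipschitz_on K (F i)" "L-lipschitz_on K (F j)" "L-lipschitz_on K G"
    and M: "\<And>x. x \<in> K \<Longrightarrow> norm (F i x) \<le> M" "\<And>x. x \<in> K \<Longrightarrow> norm (F j x) \<le> M" "\<And>x. x \<in> K \<Longrightarrow> norm (G x) \<le> M"
    and h: "0 \<le> h" "h \<le> 1" and \<mu>: "0 \<le> \<mu>" "\<mu> \<le> 1"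
    and K\<psi>: "\<And>s. s \<in> {0..1} \<Longrightarrow> \<psi> (- s) y \<in> K"
    and K\<phi>: "\<And>r s. r \<in> {0..1} \<Longrightarrow> s \<in> {0..1} \<Longrightarrow> \<phi> (- r) (\<psi> (- s) y) \<in> K"
    and z: "\<And>s. s \<in> {t - h..t} \<Longrightarrow> (z has_vector_derivative G (z s)) (at s within {t - h..t})"
    and Kz: "\<And>s. s \<in> {t - h..t} \<Longrightarrow> z s \<in> K"
    and G: "G (z t) = (1 - \<mu>) *\<^sub>R F i (z t) + \<mu> *\<^sub>R F j (z t)"
  obtains \<sigma> E I where "evolution C F (t - h) t \<sigma> E I"
    "norm (I y - z (t - h)) \<le> (1 + L * h) * norm (y - z t) + 4 * L * M * h\<^sup>2"
    "\<And>u. u \<in> {t - h..t} \<Longrightarrow> norm (E u (I y) - z u) \<le> norm (y - z t) + 3 * M * h"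
proof -
  \<comment> \<open>\<open>p\<close> is the time spent along \<open>F j\<close>, \<open>q\<close>
    the time spent along \<open>F i\<close>; \<open>y1\<close> and \<open>y0\<close> are the points
    reached backwards after the first and the second phase.\<close>
  define p where "p = \<mu> * h"
  define q where "q = (1 - \<mu>) * h"
  have pq: "0 \<le> p" "p \<le> h" "0 \<le> q" "q \<le> h" "p + q = h"
    using h \<mu> mult_right_mono[of \<mu> 1 h] unfolding p_def q_def by (auto simp: algebra_simps)
  have L0: "0 \<le> L" using L(1) by (rule lipschitz_on_nonneg)
  have zt: "z t \<in> K" using h by (intro Kz) simp
  have yK: "y \<in> K" using K\<psi>[of 0] is_flow_ofD(2)[OF \<psi>(1)] by simp
  have M0: "0 \<le> M" using M(1)[OF zt] norm_ge_zero order_trans by blast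
  define y1 where "y1 = \<psi> (- p) y"
  define y0 where "y0 = \<phi> (- q) y1"
  have y1K: "y1 \<in> K" unfolding y1_def using pq h by (intro K\<psi>) auto
  have neg: "L-lipschitz_on K (\<lambda>x. - X x)" if "L-lipschitz_on K X" for X :: "real^'n \<Rightarrow> real^'n"
    using that by (simp add: lipschitz_on_minus)
  note e\<psi> = euler_step_error[where h=p and w="\<lambda>s. \<psi> (- s) y" and X="\<lambda>x. - F j x" and K=K, OF _ _ neg[OF L(2)], of M]
  have \<psi>_der: "((\<lambda>s. \<psi> (- s) y) has_vector_derivative - F j (\<psi> (- t) y)) (at t within S)" for t S
    using flow_shift_deriv(2)[OF \<psi>(1), of 0] by simp
  have \<phi>_der: "((\<lambda>s. \<phi> (- s) y1) has_vector_derivative - F i (\<phi> (- t) y1)) (at t within S)" for t S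
    using flow_shift_deriv(2)[OF \<phi>(1), of 0] by simp
  have e\<psi>1: "norm (\<psi> (- s) y - y) \<le> M * p" if "s \<in> {0..p}" for s
    using e\<psi>(1)[OF \<psi>_der _ _ _ that] K\<psi> M(2) pq h is_flow_ofD(2)[OF \<psi>(1)] by simp
  have e\<psi>2: "norm (y1 - y + p *\<^sub>R F j y) \<le> L * M * p\<^sup>2"
    using e\<psi>(2)[OF \<psi>_der] K\<psi> M(2) pq h is_flow_ofD(2)[OF \<psi>(1)] by (simp add: y1_def)
  note e\<phi> = euler_step_error[where h=q and w="\<lambda>s. \<phi> (- s) y1" and X="\<lambda>x. - F i x" and K=K, OF _ _ neg[OF L(1)], of M]
  have K\<phi>': "\<phi> (- r) y1 \<in> K" if "r \<in> {0..q}" for r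
    unfolding y1_def using that pq h by (intro K\<phi>) auto
  have e\<phi>1: "norm (\<phi> (- s) y1 - y1) \<le> M * q" if "s \<in> {0..q}" for s
    using e\<phi>(1)[OF \<phi>_der _ _ _ that] K\<phi>' M(1) pq is_flow_ofD(2)[OF \<phi>(1)] by simp
  have e\<phi>2: "norm (y0 - y1 + q *\<^sub>R F i y1) \<le> L * M * q\<^sup>2"
    using e\<phi>(2)[OF \<phi>_der] K\<phi>' M(1) pq is_flow_ofD(2)[OF \<phi>(1)] by (simp add: y0_def)
  have z_der: "((\<lambda>s. z (t - s)) has_vector_derivative - G (z (t - s))) (at s within {0..h})" if "s \<in> {0..h}" for s
  proof -
    have d: "((\<lambda>s. t - s) has_vector_derivative - 1) (at s within {0..h})"
      by (simp flip: has_real_derivative_iff_has_vector_derivative) (auto intro!: derivative_eq_intros)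
    have im: "(\<lambda>s. t - s) ` {0..h} \<subseteq> {t - h..t}" by auto
    have "(z has_vector_derivative G (z (t - s))) (at (t - s) within (\<lambda>s. t - s) ` {0..h})"
      using z[of "t - s"] that im by (auto intro: has_vector_derivative_within_subset)
    from vector_diff_chain_within[OF d this] show ?thesis by (simp add: o_def)
  qed
  note ez = euler_step_error[where h=h and w="\<lambda>s. z (t - s)" and X="\<lambda>x. - G x" and K=K, OF z_der _ neg[OF L(3)], of M]
  have ez1: "norm (z (t - s) - z t) \<le> M * h" if "s \<in> {0..h}" for s
    using ez(1)[OF _ _ _ _ that] Kz M(3) h by simp
  have ez2: "norm (z (t - h) - z t + h *\<^sub>R G (z t)) \<le> L * M * h\<^sup>2"
    using ez(2) Kz M(3) h by simp
  define e where "e = norm (y - z t)"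
  have e0: "0 \<le> e" by (simp add: e_def)
  have l1: "norm (F i y1 - F i y) \<le> L * (M * p)"
  proof -
    have "norm (F i y1 - F i y) \<le> L * norm (y1 - y)"
      using lipschitz_onD[OF L(1) y1K yK] by (simp add: dist_norm)
    also have "\<dots> \<le> L * (M * p)" using e\<psi>1[of p] pq L0 by (intro mult_left_mono) (auto simp: y1_def)
    finally show ?thesis .
  qed
  have l2: "norm (F i y - F i (z t)) \<le> L * e" "norm (F j y - F j (z t)) \<le> L * e"
    using lipschitz_onD[OF L(1) yK zt] lipschitz_onD[OF L(2) yK zt] by (simp_all add: dist_norm e_def)
  \<comment> \<open>Three Euler remainders, the error at time \<open>t\<close>, and the variation of
    the fields between \<open>y1\<close>, \<open>y\<close> and \<open>z t\<close>. The terms linear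
    in the fields at \<open>z t\<close> cancel since \<open>q\<close> and \<open>p\<close> are
    \<open>h\<close> times the weights in \<open>G (z t)\<close>.\<close>
  have "y0 - z (t - h) = (y0 - y1 + q *\<^sub>R F i y1) + (y1 - y + p *\<^sub>R F j y)
      - (z (t - h) - z t + h *\<^sub>R G (z t)) + (y - z t) - q *\<^sub>R (F i y1 - F i y)
      - q *\<^sub>R (F i y - F i (z t)) - p *\<^sub>R (F j y - F j (z t))"
    unfolding G p_def q_def by (simp add: algebra_simps)
  also have "norm \<dots> \<le> norm (y0 - y1 + q *\<^sub>R F i y1) + norm (y1 - y + p *\<^sub>R F j y)
      + norm (z (t - h) - z t + h *\<^sub>R G (z t)) + norm (y - z t) + norm (q *\<^sub>R (F i y1 - F i y))
      + norm (q *\<^sub>R (F i y - F i (z t))) + norm (p *\<^sub>R (F j y - F j (z t)))"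
    by (intro norm_triangle_le norm_triangle_le_diff add_mono order_refl)
  also have "\<dots> \<le> L * M * q\<^sup>2 + L * M * p\<^sup>2 + L * M * h\<^sup>2 + e + q * (L * (M * p)) + q * (L * e) + p * (L * e)"
    using e\<phi>2 e\<psi>2 ez2 l1 l2 pq by (intro add_mono) (auto simp: e_def intro: mult_left_mono)
  also have "\<dots> = e + L * h * e + L * M * (q\<^sup>2 + p\<^sup>2 + h\<^sup>2 + q * p)"
    unfolding pq(5)[symmetric] by (simp add: algebra_simps)
  \<comment> \<open>Each of the four products is at most the square of \<open>h\<close>, which gives
    the constant 4.\<close>
  also have "\<dots> \<le> e + L * h * e + L * M * (h\<^sup>2 + h\<^sup>2 + h\<^sup>2 + h * h)"
    using pq L0 M0 h by (intro add_left_mono mult_left_mono add_mono power_mono mult_mono) auto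
  finally have err: "norm (y0 - z (t - h)) \<le> (1 + L * h) * e + 4 * L * M * h\<^sup>2"
    by (simp add: algebra_simps power2_eq_square)
  define c where "c = t - p"
  have c: "t - h \<le> c" "c \<le> t" "c - (t - h) = q" using pq by (auto simp: c_def)
  \<comment> \<open>Forwards in time the order of the phases is reversed: \<open>F i\<close> up to
    the switching instant \<open>c\<close>, then \<open>F j\<close>.\<close>
  define E where "E u x = (if u \<le> c then \<phi> (u - (t - h)) x else \<psi> (u - c) (\<phi> (c - (t - h)) x))" for u x
  have ev: "evolution C F (t - h) t (\<lambda>u. if u < c then i else j) E (\<phi> (t - h - c) \<circ> \<psi> (c - t))"
    unfolding E_def by (intro evolution_concat evolution_flow \<phi> \<psi> c)
  have I: "(\<phi> (t - h - c) \<circ> \<psi> (c - t)) y = y0"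
    using c(3) by (simp add: y0_def y1_def c_def algebra_simps flip: c(3))
  \<comment> \<open>The constant 3 consists of at most \<open>M * h\<close> for each of the two
    phases and \<open>M * h\<close> for the motion of \<open>z\<close> itself.\<close>
  have "norm (E u y0 - z u) \<le> e + 3 * M * h" if u: "u \<in> {t - h..t}" for u
  proof -
    have ph: "M * p \<le> M * h" "M * q \<le> M * h" using pq M0 by (auto intro: mult_left_mono)
    have zu: "norm (z u - z t) \<le> M * h" using ez1[of "t - u"] u by simp
    have Ey: "norm (E u y0 - y) \<le> M * h + M * h"
    proof (cases "u \<le> c")
      case True
      have arg: "u - (t - h) + - q = - (c - u)" using c(3) by simp
      have "\<phi> (- (c - u)) y1 = \<phi> (u - (t - h)) y0"
        using is_flow_ofD(3)[OF \<phi>(1), of "u - (t - h)" "- q" y1] unfolding arg y0_def .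
      then have "E u y0 = \<phi> (- (c - u)) y1" using True by (simp add: E_def)
      moreover have "norm (\<phi> (- (c - u)) y1 - y1) \<le> M * q" using u True c(3) by (intro e\<phi>1) auto
      moreover have "norm (y1 - y) \<le> M * p" unfolding y1_def using pq by (intro e\<psi>1) auto
      moreover have "norm (E u y0 - y) \<le> norm (E u y0 - y1) + norm (y1 - y)"
        using norm_triangle_ineq[of "E u y0 - y1" "y1 - y"] by simp
      ultimately show ?thesis using ph by auto
    next
      case False
      have "\<phi> (q + (- q)) y1 = \<phi> q y0" unfolding y0_def by (rule is_flow_ofD(3)[OF \<phi>(1)])
      then have "\<phi> q y0 = y1" using is_flow_ofD(2)[OF \<phi>(1)] by simp
      moreover have arg: "u - c + - p = - (t - u)" by (simp add: c_def)
      have "\<psi> (- (t - u)) y = \<psi> (u - c) y1"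
        using is_flow_ofD(3)[OF \<psi>(1), of "u - c" "- p" y] unfolding arg y1_def .
      ultimately have "E u y0 = \<psi> (- (t - u)) y" using False c(3) by (simp add: E_def)
      moreover have "norm (\<psi> (- (t - u)) y - y) \<le> M * p" using u False by (intro e\<psi>1) (auto simp: c_def)
      ultimately show ?thesis using ph mult_nonneg_nonneg[OF M0 h(1)] by simp
    qed
    have "norm (E u y0 - z u) \<le> norm (E u y0 - y) + norm (y - z t) + norm (z u - z t)"
      using norm_triangle_ineq[of "E u y0 - y" "y - z t"] norm_triangle_ineq4[of "E u y0 - z t" "z u - z t"] by simp
    then show ?thesis using Ey zu by (simp add: e_def)
  qed
  then show thesis using that[OF ev] err unfolding I e_def by blast
qed

text \<open>Iterates the backward step \<open>m\<close> times from the common end point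
  \<open>z b\<close>, where the error is zero. A discrete Gronwall estimate makes the accumulated
  error of order \<open>h\<close>, so it falls below the tolerance when the steps are short
  enough.\<close>

lemma convex_combination_shadowed:
  fixes F :: "nat \<Rightarrow> real ^ 'n \<Rightarrow> real ^ 'n"
  assumes \<phi>: "is_flow_of (F i) \<phi>" "i \<in> C" and \<psi>: "is_flow_of (F j) \<psi>" "j \<in> C"
    and ll: "locally_lipschitz (F i)" "locally_lipschitz (F j)" "locally_lipschitz G"
    and G: "\<And>x. \<exists>\<mu>\<in>{0..1}. G x = (1 - \<mu>) *\<^sub>R F i x + \<mu> *\<^sub>R F j x"
    and ab: "a \<le> b"
    and z: "\<And>s. s \<in> {a..b} \<Longrightarrow> (z has_vector_derivative G (z s)) (at s within {a..b})"
    and \<eta>: "0 < \<eta>"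
  obtains \<sigma> E I where "evolution C F a b \<sigma> E I"
    "\<And>u. u \<in> {a..b} \<Longrightarrow> norm (E u (I (z b)) - z u) < \<eta>"
proof -
  have "continuous_on {a..b} z" using z by (rule continuous_on_vector_derivative)
  then have "bounded (z ` {a..b})" by (intro compact_imp_bounded compact_continuous_image) auto
  then obtain R where "\<forall>x\<in>z ` {a..b}. norm x \<le> R" unfolding bounded_iff by blast
  then have R: "norm (z u) \<le> R" if "u \<in> {a..b}" for u using that by blast
  \<comment> \<open>\<open>K0\<close> contains every point within distance 1 of the curve.
    \<open>K1\<close> and \<open>K2\<close> add what the backward phases of length at most 1 can
    reach from there, so that one Lipschitz constant and one speed bound serve all steps.\<close>
  define K0 where "K0 = cball (0 :: real^'n) (R + 1)"
  define K1 where "K1 = (\<lambda>(s, x). \<psi> (- s) x) ` ({0..1} \<times> K0)"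
  define K2 where "K2 = (\<lambda>(s, x). \<phi> (- s) x) ` ({0..1} \<times> K1)"
  define K where "K = K0 \<union> K1 \<union> K2"
  have "compact K0" by (simp add: K0_def)
  moreover have "compact K1" unfolding K1_def split_def using \<open>compact K0\<close>
    by (intro compact_continuous_image compact_Times flow_continuous_on[OF \<psi>(1)] continuous_intros) auto
  moreover have "compact K2" unfolding K2_def split_def using \<open>compact K1\<close>
    by (intro compact_continuous_image compact_Times flow_continuous_on[OF \<phi>(1)] continuous_intros) auto
  ultimately have K: "compact K" by (simp add: K_def compact_Un)
  obtain L1 L2 L3 where L: "L1-lipschitz_on K (F i)" "L2-lipschitz_on K (F j)" "L3-lipschitz_on K G"
    using locally_lipschitz_on_compact[OF _ K] ll by metis
  define L where "L = max L1 (max L2 L3)"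
  have LL: "L-lipschitz_on K (F i)" "L-lipschitz_on K (F j)" "L-lipschitz_on K G"
    by (rule lipschitz_on_le[OF L(1)], simp add: L_def)
      (rule lipschitz_on_le[OF L(2)], simp add: L_def, rule lipschitz_on_le[OF L(3)], simp add: L_def)
  have L0: "0 \<le> L" using LL(1) by (rule lipschitz_on_nonneg)
  have "bounded (F i ` K \<union> F j ` K \<union> G ` K)"
    using K by (intro compact_imp_bounded compact_Un compact_continuous_image locally_lipschitz_continuous_on ll) auto
  then obtain M where M: "M > 0" "\<And>x. x \<in> F i ` K \<union> F j ` K \<union> G ` K \<Longrightarrow> norm x \<le> M"
    unfolding bounded_pos by blast
  define D where "D = b - a"
  \<comment> \<open>Chosen so that \<open>err n + 3 * M * h\<close> is at most
    \<open>h * Q - h\<close> for all \<open>n \<le> m\<close>. The summand 1 ensures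
    \<open>h \<le> h * Q\<close>.\<close>
  define Q where "Q = 4 * L * M * D * exp (L * D) + 3 * M + 1"
  have D0: "0 \<le> D" using ab by (simp add: D_def)
  have Q0: "Q \<ge> 1" using D0 L0 M(1) by (simp add: Q_def)
  \<comment> \<open>A tolerance of at most 1 keeps the backward points in \<open>K0\<close> and
    forces \<open>h \<le> 1\<close>.\<close>
  define \<eta>' where "\<eta>' = min \<eta> 1"
  have \<eta>': "0 < \<eta>'" "\<eta>' \<le> \<eta>" "\<eta>' \<le> 1" using \<eta> by (auto simp: \<eta>'_def)
  obtain m :: nat where m: "D * Q / \<eta>' < real m" using reals_Archimedean2 by blast
  have "0 \<le> D * Q / \<eta>'" using D0 Q0 \<eta>' by simp
  then have m0: "0 < real m" using m by linarith
  define h where "h = D / real m"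
  have h0: "0 \<le> h" using D0 by (simp add: h_def)
  have hQ: "h * Q < \<eta>'" using m m0 \<eta>'(1) by (simp add: h_def field_simps)
  have mh: "real m * h = D" using m0 by (simp add: h_def)
  have "h * 1 \<le> h * Q" using h0 Q0 by (intro mult_left_mono)
  then have h1: "h \<le> 1" using hQ \<eta>' by linarith
  \<comment> \<open>An explicit supersolution of the error recursion, as \<open>err_step\<close>
    verifies by means of \<open>1 + L * h \<le> exp (L * h)\<close>.\<close>
  define err where "err n = 4 * L * M * real n * h\<^sup>2 * exp (L * (real n * h))" for n :: nat
  have nh: "real n * h \<le> D" if "n \<le> m" for n
    using that h0 mult_right_mono[of "real n" "real m" h] mh by simp
  have err_le: "err n + 3 * M * h < \<eta>'" if "n \<le> m" for n
  proof -
    have "err n = 4 * L * M * h * ((real n * h) * exp (L * (real n * h)))"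
      by (simp add: err_def power2_eq_square)
    also have "\<dots> \<le> 4 * L * M * h * (D * exp (L * D))"
      using nh[OF that] h0 L0 M(1) D0 by (intro mult_left_mono mult_mono) (auto intro: mult_left_mono)
    finally have "err n + 3 * M * h \<le> h * Q - h" by (simp add: Q_def algebra_simps)
    then show ?thesis using hQ h0 by linarith
  qed
  have err_step: "(1 + L * h) * err n + 4 * L * M * h\<^sup>2 \<le> err (Suc n)" for n
  proof -
    define X where "X = exp (L * (real n * h))"
    define Y where "Y = 4 * L * M * h\<^sup>2"
    have X: "1 \<le> X" and Y: "0 \<le> Y" using L0 h0 M(1) by (auto simp: X_def Y_def)
    have step: "(1 + L * h) * X \<le> exp (L * (real (Suc n) * h))"
    proof -
      have "exp (L * (real (Suc n) * h)) = exp (L * h) * X" by (simp add: X_def exp_add[symmetric] algebra_simps)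
      then show ?thesis using exp_ge_add_one_self[of "L * h"] X by (simp add: mult_right_mono)
    qed
    have "1 * 1 \<le> (1 + L * h) * X" using X L0 h0 by (intro mult_mono) auto
    then have "1 \<le> exp (L * (real (Suc n) * h))" using step by linarith
    then have "Y * (real n * ((1 + L * h) * X)) + Y * 1
        \<le> Y * (real n * exp (L * (real (Suc n) * h))) + Y * exp (L * (real (Suc n) * h))"
      using step Y by (intro add_mono mult_left_mono) auto
    then show ?thesis by (simp add: err_def X_def Y_def algebra_simps)
  qed
  \<comment> \<open>Induction on the number of steps already taken backwards from \<open>b\<close>.
    It starts with the degenerate interval from \<open>b\<close> to \<open>b\<close>, where any
    admissible flow will do.\<close>
  have "\<exists>\<sigma> E I. evolution C F (b - real n * h) b \<sigma> E I \<and> norm (I (z b) - z (b - real n * h)) \<le> err n \<and>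
      (\<forall>u\<in>{b - real n * h..b}. norm (E u (I (z b)) - z u) < \<eta>)" if "n \<le> m" for n
    using that
  proof (induction n)
    case 0
    show ?case
    proof (intro exI conjI)
      show "evolution C F (b - real 0 * h) b (\<lambda>_. i) (\<lambda>t. \<phi> (t - (b - real 0 * h))) (\<phi> (b - real 0 * h - b))"
        using \<phi> by (intro evolution_flow) auto
    qed (use \<eta> is_flow_ofD(2)[OF \<phi>(1)] in \<open>auto simp: err_def\<close>)
  next
    case (Suc n)
    then obtain \<sigma> E I where IH: "evolution C F (b - real n * h) b \<sigma> E I"
      "norm (I (z b) - z (b - real n * h)) \<le> err n"
      "\<And>u. u \<in> {b - real n * h..b} \<Longrightarrow> norm (E u (I (z b)) - z u) < \<eta>" by auto
    define t where "t = b - real n * h"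
    define y where "y = I (z b)"
    have t: "t \<le> b" "a \<le> t - h" "t - h = b - real (Suc n) * h"
      using nh[of "Suc n"] Suc.prems h0 by (auto simp: t_def D_def algebra_simps)
    have ta: "a \<le> t" using t h0 by simp
    have en: "err n + 3 * M * h < \<eta>'" using Suc.prems by (intro err_le) simp
    have "norm y \<le> norm (y - z t) + norm (z t)" using norm_triangle_ineq[of "y - z t" "z t"] by simp
    moreover have "norm (y - z t) \<le> 1"
      using IH(2) en h0 M(1) \<eta>'(3) mult_nonneg_nonneg[of M h] unfolding y_def t_def by linarith
    ultimately have y0: "y \<in> K0" using R[of t] ta t(1) by (auto simp: K0_def)
    obtain \<mu> where \<mu>: "\<mu> \<in> {0..1}" "G (z t) = (1 - \<mu>) *\<^sub>R F i (z t) + \<mu> *\<^sub>R F j (z t)" using G by blast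
    have y1: "\<psi> (- s) y \<in> K1" if "s \<in> {0..1}" for s using y0 that by (auto simp: K1_def)
    have y2: "\<phi> (- r) (\<psi> (- s) y) \<in> K2" if "r \<in> {0..1}" "s \<in> {0..1}" for r s
      using y1[OF that(2)] that(1) by (auto simp: K2_def)
    have sub: "{t - h..t} \<subseteq> {a..b}" using t by auto
    obtain \<sigma>' E' I' where step: "evolution C F (t - h) t \<sigma>' E' I'"
      "norm (I' y - z (t - h)) \<le> (1 + L * h) * norm (y - z t) + 4 * L * M * h\<^sup>2"
      "\<And>u. u \<in> {t - h..t} \<Longrightarrow> norm (E' u (I' y) - z u) \<le> norm (y - z t) + 3 * M * h"
    proof (rule backward_step[OF \<phi> \<psi> LL, where M=M and h=h and \<mu>=\<mu> and y=y and z=z and t=t])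
      show "z s \<in> K" if "s \<in> {t - h..t}" for s
      proof -
        have "norm (z s) \<le> R" using that sub by (intro R) blast
        then show ?thesis by (simp add: K_def K0_def)
      qed
      show "(z has_vector_derivative G (z s)) (at s within {t - h..t})" if "s \<in> {t - h..t}" for s
        using z[of s] that sub by (meson has_vector_derivative_within_subset subsetD)
    qed (use M(2) h0 h1 \<mu> y1 y2 in \<open>auto simp: K_def\<close>)
    note cc = evolution_concat[OF step(1) IH(1)[folded t_def]]
    have inv: "E' t (I' y) = y" using step(1) unfolding evolution_def by blast
    show ?case
    proof (intro exI conjI)
      show "evolution C F (b - real (Suc n) * h) b (\<lambda>u. if u < t then \<sigma>' u else \<sigma> u)
         (\<lambda>u x. if u \<le> t then E' u x else E u (E' t x)) (I' \<circ> I)"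
        using cc unfolding t(3) .
      have "norm (I' y - z (t - h)) \<le> (1 + L * h) * err n + 4 * L * M * h\<^sup>2"
        using step(2) IH(2) L0 h0 mult_left_mono[of "norm (y - z t)" "err n" "1 + L * h"]
        unfolding y_def t_def by simp
      also have "\<dots> \<le> err (Suc n)" by (rule err_step)
      finally show "norm ((I' \<circ> I) (z b) - z (b - real (Suc n) * h)) \<le> err (Suc n)"
        by (simp add: y_def t(3))
      show "\<forall>u\<in>{b - real (Suc n) * h..b}.
          norm ((if u \<le> t then E' u ((I' \<circ> I) (z b)) else E u (E' t ((I' \<circ> I) (z b)))) - z u) < \<eta>"
      proof
        fix u assume u: "u \<in> {b - real (Suc n) * h..b}"
        show "norm ((if u \<le> t then E' u ((I' \<circ> I) (z b)) else E u (E' t ((I' \<circ> I) (z b)))) - z u) < \<eta>"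
        proof (cases "u \<le> t")
          case True
          then have "norm (E' u (I' y) - z u) \<le> norm (y - z t) + 3 * M * h" using u t(3) by (intro step(3)) auto
          also have "\<dots> < \<eta>" using IH(2) en \<eta>'(2) unfolding y_def t_def by linarith
          finally show ?thesis using True by (simp add: y_def)
        next
          case False
          then show ?thesis using IH(3)[of u] u inv by (simp add: y_def t_def)
        qed
      qed
    qed
  qed
  from this[of m] obtain \<sigma> E I where "evolution C F (b - real m * h) b \<sigma> E I"
    "\<forall>u\<in>{b - real m * h..b}. norm (E u (I (z b)) - z u) < \<eta>" by blast
  moreover have "b - real m * h = a" by (simp add: mh D_def)
  ultimately show thesis using that by simp
qed

section \<open>Solutions of convex combinations\<close>

lemma evolution_continuous_on:
  assumes "evolution C F a b \<sigma> E I" "continuous_on S f" "continuous_on S g" "f ` S \<subseteq> {a..b}"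
  shows "continuous_on S (\<lambda>s. E (f s) (g s))"
proof -
  have E: "continuous_on ({a..b} \<times> UNIV) (\<lambda>(t, x). E t x)" using assms(1) unfolding evolution_def by blast
  have "continuous_on S (\<lambda>s. case (f s, g s) of (t, x) \<Rightarrow> E t x)"
    by (rule continuous_on_compose2[OF E continuous_on_Pair[OF assms(2,3)]]) (use assms(4) in auto)
  then show ?thesis by simp
qed

lemma evolution_inverse:
  assumes "evolution C F a b \<sigma> E I"
  shows "E a x = x" "E b (I x) = x" "continuous_on S I"
proof -
  show "E a x = x" "E b (I x) = x" using assms unfolding evolution_def by blast+
  have "continuous_on UNIV I" using assms unfolding evolution_def by blast
  then show "continuous_on S I" by (rule continuous_on_subset) simp
qed

lemma evolution_follows:
  assumes "evolution C F a b \<sigma> E I"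
  shows "t \<in> {a..<b} \<Longrightarrow> follows_right F \<sigma> (\<lambda>s. E s x) t"
    and "t \<in> {a<..b} \<Longrightarrow> follows_left F \<sigma> (\<lambda>s. E s x) t"
    and "\<sigma> u \<in> C"
  using assms unfolding evolution_def by blast+

text \<open>The evolution says nothing about the regularity of its signal beyond \<open>b\<close>;
  freezing the signal from \<open>b\<close> on makes it a switching signal on the whole half-line
  without changing the curve on the interval.\<close>

lemma evolution_switched_solution:
  assumes ev: "evolution {1..k} F 0 b \<sigma> E I" and b: "0 < b"
  obtains \<tau> where "switching_signal k \<tau>" "switched_solution F \<tau> (ereal b) (\<lambda>t. E t x)"
proof -
  define \<tau> where "\<tau> u = (if u < b then \<sigma> u else \<sigma> b)" for u
  have R: "follows_right F \<tau> (\<lambda>t. E t x) t" if "0 \<le> t" "t < b" for t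
    using evolution_follows(1)[OF ev, of t x] that
    by (subst follows_right_cong[of t b _ \<sigma> _ "\<lambda>t. E t x"]) (auto simp: \<tau>_def)
  have L: "follows_left F \<tau> (\<lambda>t. E t x) t" if "0 < t" "t \<le> b" for t
    using evolution_follows(2)[OF ev, of t x] that
    by (subst follows_left_cong[of 0 t _ \<sigma> _ "\<lambda>t. E t x"]) (auto simp: \<tau>_def)
  have "\<tau> t \<in> {1..k}" for t using evolution_follows(3)[OF ev] by (simp add: \<tau>_def)
  moreover have "\<forall>\<^sub>F u in at_right t. \<tau> u = \<tau> t" if "0 \<le> t" for t
  proof (cases "t < b")
    case True
    then show ?thesis using R[OF that] by (simp add: follows_right_def)
  next
    case False
    then show ?thesis by (auto simp: \<tau>_def eventually_at_right_field intro!: exI[of _ "t + 1"])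
  qed
  moreover have "\<exists>c. \<forall>\<^sub>F u in at_left t. \<tau> u = c" if "0 < t" for t
  proof (cases "t \<le> b")
    case True
    then show ?thesis using L[OF that] by (auto simp: follows_left_def)
  next
    case False
    then show ?thesis by (auto simp: \<tau>_def eventually_at_left_field intro!: exI[of _ "\<sigma> b"] exI[of _ b])
  qed
  ultimately show thesis
    using switched_solutionI[of \<tau> k "ereal b" F "\<lambda>t. E t x"] R L b that by auto
qed

lemma forward_solution_shift:
  assumes "forward_solution G T z" "0 \<le> a" "ereal a < T"
  shows "forward_solution G (T - ereal a) (\<lambda>t. z (a + t))"
  unfolding forward_solution_def
proof (intro conjI allI impI)
  show "0 < T - ereal a" using assms by (cases T) auto
  fix t :: real assume t: "0 \<le> t" "ereal t < T - ereal a"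
  then have "ereal (a + t) < T" by (cases T) auto
  then have z: "(z has_vector_derivative G (z (a + t))) (at (a + t) within {0..})"
    using assms t unfolding forward_solution_def by auto
  have "((\<lambda>t. a + t) has_vector_derivative 1) (at t within {0..})"
    by (simp flip: has_real_derivative_iff_has_vector_derivative) (auto intro!: derivative_eq_intros)
  moreover have "(z has_vector_derivative G (z (a + t))) (at (a + t) within (\<lambda>t. a + t) ` {0..})"
    by (rule has_vector_derivative_within_subset[OF z]) (use assms in auto)
  ultimately have "(z \<circ> (\<lambda>t. a + t) has_vector_derivative 1 *\<^sub>R G (z (a + t))) (at t within {0..})"
    by (rule vector_diff_chain_within)
  then show "((\<lambda>t. z (a + t)) has_vector_derivative G (z (a + t))) (at t within {0..})"
    by (simp add: o_def)
qed

lemma forward_solution_Icc: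
  assumes "forward_solution G T z" "0 \<le> a" "ereal b < T" "t \<in> {a..b}"
  shows "(z has_vector_derivative G (z t)) (at t within {a..b})"
proof -
  have "ereal t < T" using assms(3,4) by (auto intro: le_less_trans[of _ "ereal b"])
  then have "(z has_vector_derivative G (z t)) (at t within {0..})"
    using assms unfolding forward_solution_def by auto
  then show ?thesis by (rule has_vector_derivative_within_subset) (use assms in auto)
qed

lemma flow_forward_solution:
  assumes "is_flow_of X \<phi>"
  shows "maximal_solution (forward_solution X) \<infinity> (\<lambda>t. \<phi> t x)"
  unfolding maximal_solution_def forward_solution_def
  using is_flow_ofD(4)[OF assms] by (auto simp: has_vector_derivative_at_within)

text \<open>Stability gives a neighbourhood \<open>V\<close> whose orbits remain in the unit ball.
  By attractivity and compactness, every orbit from \<open>K\<close> visits \<open>V\<close> before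
  a common time \<open>N\<close>; up to that time the orbits fill a compact set.\<close>

lemma GAS_flow_bounded:
  assumes \<phi>: "is_flow_of X \<phi>" and gas: "GAS X" and K: "compact K"
  obtains M where "\<And>t x. 0 \<le> t \<Longrightarrow> x \<in> K \<Longrightarrow> norm (\<phi> t x) \<le> M"
proof -
  have sol: "forward_solution X \<infinity> (\<lambda>t. \<phi> t x)" for x
    using flow_forward_solution[OF \<phi>, of x] by (simp add: maximal_solution_def)
  obtain V where V: "open V" "0 \<in> V" and stab: "\<And>x t. x \<in> V \<Longrightarrow> 0 \<le> t \<Longrightarrow> \<phi> t x \<in> ball 0 1"
  proof -
    from gas obtain V where V: "open V" "0 \<in> V"
      and *: "\<forall>T x. forward_solution X T x \<and> x 0 \<in> V \<longrightarrow> (\<forall>t\<ge>0. ereal t < T \<longrightarrow> x t \<in> ball 0 1)"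
      unfolding GAS_def by (meson open_ball centre_in_ball zero_less_one)
    show thesis
    proof (rule that[OF V])
      show "\<phi> t x \<in> ball 0 1" if "x \<in> V" "0 \<le> t" for x t
        using *[rule_format, of \<infinity> "\<lambda>t. \<phi> t x" t] sol[of x] that is_flow_ofD(2)[OF \<phi>] by simp
    qed
  qed
  \<comment> \<open>The points that lie in \<open>V\<close> at the integer time \<open>n\<close>;
    attractivity makes these open sets a cover of \<open>K\<close>.\<close>
  define W where "W n = \<phi> (real n) -` V" for n :: nat
  have \<phi>c: "continuous_on UNIV (\<phi> (real n))" for n
    by (rule flow_continuous_on[OF \<phi> continuous_on_const continuous_on_id])
  have W: "open (W n)" for n
    unfolding W_def using V(1) \<phi>c by (simp add: open_vimage continuous_on_eq_continuous_at)
  have KW: "K \<subseteq> \<Union> (range W)"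
  proof
    fix x assume "x \<in> K"
    have "((\<lambda>t. \<phi> t x) \<longlongrightarrow> 0) at_top"
      using gas flow_forward_solution[OF \<phi>, of x] unfolding GAS_def by blast
    then have "((\<lambda>n. \<phi> (real n) x) \<longlongrightarrow> 0) sequentially"
      by (rule filterlim_compose[OF _ filterlim_real_sequentially])
    then have "\<forall>\<^sub>F n in sequentially. \<phi> (real n) x \<in> V" using V by (rule topological_tendstoD)
    then obtain n where "\<phi> (real n) x \<in> V" by (auto simp: eventually_sequentially)
    then show "x \<in> \<Union> (range W)" by (auto simp: W_def)
  qed
  obtain A where A: "finite A" "K \<subseteq> (\<Union>n\<in>A. W n)"
    by (rule compactE_image[OF K, of UNIV W]) (use W KW in auto)
  obtain N where N: "\<And>n. n \<in> A \<Longrightarrow> n \<le> N" using A(1) by (meson finite_nat_set_iff_bounded_le)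
  have "compact ((\<lambda>(t, x). \<phi> t x) ` ({0..real N} \<times> K))"
    using K by (intro compact_continuous_image compact_Times
        continuous_on_subset[OF is_flow_ofD(1)[OF \<phi>]]) auto
  then have "bounded ((\<lambda>(t, x). \<phi> t x) ` ({0..real N} \<times> K))" by (rule compact_imp_bounded)
  then obtain M where M: "\<forall>y\<in>(\<lambda>(t, x). \<phi> t x) ` ({0..real N} \<times> K). norm y \<le> M"
    unfolding bounded_iff by (rule exE)
  have "norm (\<phi> t x) \<le> max M 1" if "0 \<le> t" "x \<in> K" for t x
  proof (cases "t \<le> real N")
    case True
    then have "\<phi> t x \<in> (\<lambda>(t, x). \<phi> t x) ` ({0..real N} \<times> K)" using that by auto
    with M have "norm (\<phi> t x) \<le> M" by (rule bspec)
    then show ?thesis by simp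
  next
    case False
    have "x \<in> (\<Union>n\<in>A. W n)" using that A(2) by blast
    then obtain n where n: "n \<in> A" "\<phi> (real n) x \<in> V" by (auto simp: W_def)
    have "\<phi> (t - real n) (\<phi> (real n) x) = \<phi> t x"
      using is_flow_ofD(3)[OF \<phi>, of "t - real n" "real n" x] by simp
    moreover have "\<phi> (t - real n) (\<phi> (real n) x) \<in> ball 0 1"
      using N[OF n(1)] False by (intro stab n(2)) simp
    ultimately show ?thesis by simp
  qed
  then show thesis using that by blast
qed

text \<open>The setting for a single field of the path: the values of \<open>G\<close> lie on the
  segments between those of \<open>F i\<close> and \<open>F j\<close>, so its solutions can be
  shadowed by switched solutions.\<close>

locale convex_selection =
  fixes k :: nat and F :: "nat \<Rightarrow> real ^ 'n \<Rightarrow> real ^ 'n" and i j :: nat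
    and \<phi> \<psi> :: "real \<Rightarrow> real ^ 'n \<Rightarrow> real ^ 'n" and G :: "real ^ 'n \<Rightarrow> real ^ 'n"
  assumes ij: "i \<in> {1..k}" "j \<in> {1..k}"
    and flows: "is_flow_of (F i) \<phi>" "is_flow_of (F j) \<psi>"
    and lipschitz: "locally_lipschitz (F i)" "locally_lipschitz (F j)" "locally_lipschitz G"
    and selection: "\<And>x. \<exists>\<mu>\<in>{0..1}. G x = (1 - \<mu>) *\<^sub>R F i x + \<mu> *\<^sub>R F j x"
    and switched: "switched_GAS k F"
begin

lemma shadow:
  assumes "forward_solution G T z" "0 \<le> a" "a \<le> b" "ereal b < T" "0 < \<eta>"
  obtains \<sigma> E I where "evolution {1..k} F a b \<sigma> E I"
    "\<And>u. u \<in> {a..b} \<Longrightarrow> norm (E u (I (z b)) - z u) < \<eta>"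
  using convex_combination_shadowed[OF flows(1) ij(1) flows(2) ij(2) lipschitz selection assms(3)
      forward_solution_Icc[OF assms(1,2,4)] assms(5)] by metis

text \<open>The neighbourhood \<open>V\<close> of the switched system for radius
  \<open>e / 2\<close> works for \<open>G\<close> as well: a close enough shadow also starts in
  \<open>V\<close>, hence stays within \<open>e / 2\<close> of 0, and the solution itself is within
  \<open>e / 2\<close> of its shadow.\<close>

lemma stable:
  assumes "open U" "0 \<in> U"
  obtains V where "open V" "0 \<in> V" "V \<subseteq> U"
    "\<And>T z t. forward_solution G T z \<Longrightarrow> z 0 \<in> V \<Longrightarrow> 0 \<le> t \<Longrightarrow> ereal t < T \<Longrightarrow> z t \<in> U"
proof -
  obtain e where e: "0 < e" "ball 0 e \<subseteq> U" using assms openE by blast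
  obtain V where V: "open V" "0 \<in> V" "V \<subseteq> ball 0 (e / 2)"
    and stab: "\<And>\<sigma> T x t. switching_signal k \<sigma> \<Longrightarrow> switched_solution F \<sigma> T x \<Longrightarrow> x 0 \<in> V \<Longrightarrow>
      0 \<le> t \<Longrightarrow> ereal t < T \<Longrightarrow> x t \<in> ball 0 (e / 2)"
  proof -
    have "open (ball (0::real^'n) (e / 2)) \<and> 0 \<in> ball (0::real^'n) (e / 2)" using e by simp
    from switched[unfolded switched_GAS_def, THEN conjunct1, THEN spec, THEN mp, OF this]
    obtain V where V: "open V" "0 \<in> V" "V \<subseteq> ball 0 (e / 2)"
      "\<forall>\<sigma>. switching_signal k \<sigma> \<longrightarrow> (\<forall>T x. switched_solution F \<sigma> T x \<and> x 0 \<in> V \<longrightarrow>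
         (\<forall>t\<ge>0. ereal t < T \<longrightarrow> x t \<in> ball 0 (e / 2)))"
      by (elim exE conjE)
    show thesis by (rule that[OF V(1-3)]) (rule V(4)[rule_format, OF _ conjI])
  qed
  show thesis
  proof (rule that[OF V(1,2)])
    show "V \<subseteq> U" using V(3) e subset_ball[of "e / 2" e "0 :: real^'n"] by auto
    fix T z t assume z: "forward_solution G T z" "z 0 \<in> V" and t: "0 \<le> t" "ereal t < T"
    \<comment> \<open>The shadow is a switched solution on times strictly before \<open>b\<close>
      only, so \<open>b\<close> has to lie beyond \<open>t\<close>.\<close>
    obtain b where b: "t < b" "ereal b < T" using ereal_dense2[OF t(2)] by auto
    obtain d where d: "0 < d" "ball (z 0) d \<subseteq> V" using V(1) z(2) openE by blast
    obtain \<sigma> E I where ev: "evolution {1..k} F 0 b \<sigma> E I"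
      and close: "\<And>u. u \<in> {0..b} \<Longrightarrow> norm (E u (I (z b)) - z u) < min d (e / 2)"
      using shadow[OF z(1), of 0 b "min d (e / 2)"] b t d e by auto
    define x where "x u = E u (I (z b))" for u
    have b0: "0 < b" using b t by simp
    obtain \<tau> where \<tau>: "switching_signal k \<tau>" "switched_solution F \<tau> (ereal b) x"
      using evolution_switched_solution[OF ev b0, of "I (z b)"] unfolding x_def by blast
    have "norm (x 0 - z 0) < d" using close[of 0] b0 by (simp add: x_def)
    then have "x 0 \<in> V" using d(2) by (auto simp: dist_norm norm_minus_commute)
    then have "x t \<in> ball 0 (e / 2)" using stab[OF \<tau>] t b by simp
    moreover have "norm (x t - z t) < e / 2" using close[of t] t b by (simp add: x_def)
    moreover have "norm (z t) \<le> norm (x t) + norm (x t - z t)"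
      using norm_triangle_ineq4[of "x t" "x t - z t"] by simp
    ultimately have "z t \<in> ball 0 e" by simp
    then show "z t \<in> U" using e(2) by blast
  qed
qed

end

section \<open>Uniqueness and continuation for locally Lipschitz fields\<close>

lemma locally_lipschitz_solution_unique:
  assumes X: "locally_lipschitz X"
    and x: "\<And>t. t \<in> {a..b} \<Longrightarrow> (x has_vector_derivative X (x t)) (at t within {a..b})"
    and y: "\<And>t. t \<in> {a..b} \<Longrightarrow> (y has_vector_derivative X (y t)) (at t within {a..b})"
    and eq: "x a = y a" and t: "t \<in> {a..b}"
  shows "x t = y t"
proof -
  have "compact (x ` {a..b} \<union> y ` {a..b})"
    using continuous_on_vector_derivative[OF x] continuous_on_vector_derivative[OF y]
    by (intro compact_Un compact_continuous_image) auto
  then obtain L where "L-lipschitz_on (x ` {a..b} \<union> y ` {a..b}) X"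
    by (rule locally_lipschitz_on_compact[OF X])
  from solution_unique[OF this x y _ _ eq t] show ?thesis by blast
qed

text \<open>The existence time depends on the bound \<open>M\<close> alone: the unit balls used by
  Picard's theorem all lie in one ball of radius \<open>M + 1\<close>, on which a single Lipschitz
  constant and speed bound hold.\<close>

lemma uniform_local_existence:
  fixes G :: "real ^ 'n \<Rightarrow> real ^ 'n"
  assumes G: "locally_lipschitz G"
  obtains h where "0 < h" "\<And>x0. norm x0 \<le> M \<Longrightarrow>
    \<exists>x. x 0 = x0 \<and> (\<forall>t\<in>{0..h}. (x has_vector_derivative G (x t)) (at t within {0..h}))"
proof -
  define K where "K = cball (0 :: real ^ 'n) (M + 1)"
  have K: "compact K" by (simp add: K_def)
  obtain L where L: "L-lipschitz_on K G" by (rule locally_lipschitz_on_compact[OF G K])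
  have L0: "0 \<le> L" using L by (rule lipschitz_on_nonneg)
  have "bounded (G ` K)"
    by (intro compact_imp_bounded compact_continuous_image locally_lipschitz_continuous_on G K)
  then obtain N where N: "0 < N" "\<forall>y\<in>G ` K. norm y \<le> N" unfolding bounded_pos by blast
  define h where "h = 1 / (L + N + 1)"
  have h: "0 < h" "h * N \<le> 1" "h * L < 1" using L0 N(1) by (auto simp: h_def field_simps)
  show thesis
  proof (rule that[OF h(1)])
    fix x0 :: "real ^ 'n" assume x0: "norm x0 \<le> M"
    have sub: "cball x0 1 \<subseteq> K"
    proof
      fix x assume "x \<in> cball x0 1"
      then show "x \<in> K" using x0 norm_triangle_ineq2[of x x0] by (simp add: K_def dist_norm norm_minus_commute)
    qed
    have GN: "norm (G x) \<le> N" if "x \<in> cball x0 1" for x using N(2) sub that by blast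
    obtain x where "x 0 = x0" "\<And>t. t \<in> {0..h} \<Longrightarrow> (x has_vector_derivative G (x t)) (at t within {0..h})"
      by (rule picard_local_existence[OF lipschitz_on_subset[OF L sub] GN, of h]) (use h in auto)
    then show "\<exists>x. x 0 = x0 \<and> (\<forall>t\<in>{0..h}. (x has_vector_derivative G (x t)) (at t within {0..h}))" by blast
  qed
qed

text \<open>Restarting less than the uniform existence time \<open>h\<close> before \<open>b\<close>
  carries the solution past \<open>b\<close>, and uniqueness identifies the old and the new curve on
  the overlap.\<close>

lemma bounded_solution_extends:
  assumes G: "locally_lipschitz G" and z: "forward_solution G (ereal b) z"
    and M: "\<And>t. 0 \<le> t \<Longrightarrow> t < b \<Longrightarrow> norm (z t) \<le> M"
  shows "\<exists>T y. ereal b < T \<and> forward_solution G T y \<and> (\<forall>t\<ge>0. ereal t < ereal b \<longrightarrow> y t = z t)"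
proof -
  have b: "0 < b" using z by (simp add: forward_solution_def)
  obtain h where h: "0 < h" "\<And>x0. norm x0 \<le> M \<Longrightarrow>
    \<exists>x. x 0 = x0 \<and> (\<forall>t\<in>{0..h}. (x has_vector_derivative G (x t)) (at t within {0..h}))"
    using uniform_local_existence[OF G] by metis
  define t0 where "t0 = max 0 (b - h / 2)"
  have t0: "0 \<le> t0" "t0 < b" "b < t0 + h" using b h(1) by (auto simp: t0_def)
  obtain w where w: "w 0 = z t0" "\<And>t. t \<in> {0..h} \<Longrightarrow> (w has_vector_derivative G (w t)) (at t within {0..h})"
    using h(2)[OF M[OF t0(1,2)]] by blast
  have shift: "((\<lambda>t. t - t0) has_vector_derivative 1) (at t within S)" for t S
    by (simp flip: has_real_derivative_iff_has_vector_derivative) (auto intro!: derivative_eq_intros)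
  have w': "((\<lambda>t. w (t - t0)) has_vector_derivative G (w (t - t0))) (at t within {t0..t0 + h})"
    if "t \<in> {t0..t0 + h}" for t
  proof -
    have "(w has_vector_derivative G (w (t - t0))) (at (t - t0) within (\<lambda>t. t - t0) ` {t0..t0 + h})"
      by (rule has_vector_derivative_within_subset[OF w(2)]) (use that in auto)
    from vector_diff_chain_within[OF shift this] show ?thesis by (simp add: o_def)
  qed
  \<comment> \<open>Glued at \<open>t0 < b\<close>, so that near \<open>b\<close> only
    \<open>w\<close> matters; before \<open>b\<close> the curve is \<open>z\<close> by
    uniqueness.\<close>
  define y where "y t = (if t \<le> t0 then z t else w (t - t0))" for t
  have yz: "y t = z t" if "t < b" for t
  proof (cases "t \<le> t0")
    case False
    have "z t = w (t - t0)"
    proof (rule locally_lipschitz_solution_unique[OF G, where x=z and y="\<lambda>t. w (t - t0)" and a=t0 and b=t])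
      show "(z has_vector_derivative G (z s)) (at s within {t0..t})" if "s \<in> {t0..t}" for s
        using forward_solution_Icc[OF z t0(1) _ that] \<open>t < b\<close> by simp
      show "((\<lambda>t. w (t - t0)) has_vector_derivative G (w (s - t0))) (at s within {t0..t})" if "s \<in> {t0..t}" for s
        by (rule has_vector_derivative_within_subset[OF w']) (use that \<open>t < b\<close> t0 in auto)
    qed (use False w(1) in auto)
    then show ?thesis using False by (simp add: y_def)
  qed (simp add: y_def)
  have "forward_solution G (ereal (t0 + h)) y" unfolding forward_solution_def
  proof (intro conjI allI impI)
    show "0 < ereal (t0 + h)" using t0 h by simp
    fix t assume t: "0 \<le> t" "ereal t < ereal (t0 + h)"
    show "(y has_vector_derivative G (y t)) (at t within {0..})"
    proof (cases "t < b")
      case True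
      have "(z has_vector_derivative G (z t)) (at t within {0..})"
        using z t True by (simp add: forward_solution_def)
      then have "(y has_vector_derivative G (z t)) (at t within {0..})"
        by (rule has_vector_derivative_transform_within[of _ _ _ _ "b - t"])
          (use t True yz in \<open>auto simp: dist_real_def\<close>)
      then show ?thesis using yz[OF True] by simp
    next
      case False
      have tin: "t \<in> {t0<..<t0 + h}" using False t t0 by auto
      then have "((\<lambda>t. w (t - t0)) has_vector_derivative G (w (t - t0))) (at t)"
        using w'[of t] by (simp add: at_within_Icc_at)
      then have "(y has_vector_derivative G (w (t - t0))) (at t)"
        by (rule has_vector_derivative_transform_within_open[of _ _ _ "{t0<..<t0 + h}"])
          (use tin in \<open>auto simp: y_def\<close>)
      from has_vector_derivative_at_within[OF this] show ?thesis using tin by (simp add: y_def)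
    qed
  qed
  then show ?thesis using yz t0(3) by (intro exI[of _ "ereal (t0 + h)"] exI[of _ y]) auto
qed

section \<open>Attractivity and boundedness for the convex combination\<close>

context convex_selection
begin

text \<open>Prolongs a shadow by one time unit without touching the signal or the transition maps
  built so far. The new piece prescribes at time \<open>a\<close> an end point slightly different
  from \<open>z a\<close>; by the tube lemma over the compact interval, all end points near
  \<open>z a\<close> still have a backward evolution that is \<open>r\<close>-close to
  \<open>z\<close>.\<close>

lemma shadow_extend:
  assumes z: "forward_solution G \<infinity> z" and a: "0 < a"
    and ev: "evolution {1..k} F 0 a \<sigma> E I"
    and close: "\<And>u. u \<in> {0..a} \<Longrightarrow> norm (E u (I (z a)) - z u) < r" and r: "0 < r"
  obtains \<sigma>' E' I' where "evolution {1..k} F 0 (a + 1) \<sigma>' E' I'"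
    "\<And>u. u \<in> {0..a + 1} \<Longrightarrow> norm (E' u (I' (z (a + 1))) - z u) < r"
    "\<And>u. u < a \<Longrightarrow> \<sigma>' u = \<sigma> u" "\<And>u. u \<le> a \<Longrightarrow> E' u = E u"
proof -
  \<comment> \<open>The distance to \<open>z\<close> at a given time, as a function of that time and
    of the end point prescribed at \<open>a\<close>.\<close>
  define g where "g = (\<lambda>p. norm (E (fst p) (I (snd p)) - z (fst p)))"
  have "continuous_on {0..a} z"
    using forward_solution_Icc[OF z order_refl, of a] by (intro continuous_on_vector_derivative) auto
  then have "continuous_on ({0..a} \<times> UNIV) (\<lambda>p :: real \<times> (real ^ 'n). z (fst p))"
    by (rule continuous_on_compose2) (auto intro: continuous_intros)
  moreover have "continuous_on ({0..a} \<times> UNIV) (\<lambda>p. I (snd p))"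
    by (rule continuous_on_compose2[OF evolution_inverse(3)[OF ev]]) (auto intro: continuous_intros)
  then have "continuous_on ({0..a} \<times> UNIV) (\<lambda>p. E (fst p) (I (snd p)))"
    by (intro evolution_continuous_on[OF ev] continuous_on_fst continuous_on_id) auto
  ultimately have "continuous_on ({0..a} \<times> UNIV) g" unfolding g_def by (intro continuous_intros)
  then have "openin (top_of_set ({0..a} \<times> UNIV)) (({0..a} \<times> UNIV) \<inter> g -` {..<r})"
    by (intro continuous_openin_preimage_gen) auto
  moreover have "{0..a} \<noteq> {}" using a by simp
  moreover have "(\<lambda>u. (u, z a)) ` {0..a} \<subseteq> ({0..a} \<times> UNIV) \<inter> g -` {..<r}"
    using close by (auto simp: g_def)
  ultimately obtain V where V: "openin (top_of_set UNIV) V" "z a \<in> V" "{0..a} \<times> V \<subseteq> ({0..a} \<times> UNIV) \<inter> g -` {..<r}"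
    using tube_lemma[of "{0..a}" "z a" "({0..a} \<times> UNIV) \<inter> g -` {..<r}" UNIV] by auto
  obtain d where d: "0 < d" "ball (z a) d \<subseteq> V" using V(1,2) openE[of V "z a"] by auto
  obtain \<sigma>2 E2 I2 where ev2: "evolution {1..k} F a (a + 1) \<sigma>2 E2 I2"
    and close2: "\<And>u. u \<in> {a..a + 1} \<Longrightarrow> norm (E2 u (I2 (z (a + 1))) - z u) < min d r"
    \<comment> \<open>Tolerance \<open>d\<close> puts the initial value of the new piece into
      \<open>V\<close>; tolerance \<open>r\<close> is what the new interval itself requires.\<close>
    using shadow[OF z, of a "a + 1" "min d r"] a d r by auto
  define y where "y = I2 (z (a + 1))"
  have "norm (y - z a) < d" using close2[of a] evolution_inverse(1)[OF ev2] by (simp add: y_def)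
  then have "y \<in> V" using d(2) by (auto simp: dist_norm norm_minus_commute)
  then have ylow: "norm (E u (I y) - z u) < r" if "u \<in> {0..a}" for u
  proof -
    have "(u, y) \<in> {0..a} \<times> V" using that \<open>y \<in> V\<close> by simp
    then have "g (u, y) < r" using V(3) by blast
    then show ?thesis by (simp add: g_def)
  qed
  show thesis
  proof (rule that[OF evolution_concat[OF ev ev2]])
    fix u assume u: "u \<in> {0..a + 1}"
    show "norm ((if u \<le> a then E u ((I \<circ> I2) (z (a + 1))) else E2 u (E a ((I \<circ> I2) (z (a + 1))))) - z u) < r"
    proof (cases "u \<le> a")
      case True
      then show ?thesis using ylow[of u] u by (simp add: y_def)
    next
      case False
      then show ?thesis using close2[of u] u evolution_inverse(2)[OF ev] by simp
    qed
  qed (auto simp: fun_eq_iff)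
qed

text \<open>The signals and transition maps of successive extensions agree on earlier intervals and
  define one signal for all times. The initial values change with every extension but stay in a
  compact ball; a cluster point starts the desired switched solution.\<close>

lemma shadow_forever:
  assumes z: "forward_solution G \<infinity> z" and r: "0 < r"
  obtains \<sigma> x where "switching_signal k \<sigma>" "switched_solution F \<sigma> \<infinity> x"
    "\<And>t. 0 \<le> t \<Longrightarrow> norm (x t - z t) \<le> r"
proof -
  \<comment> \<open>Stage \<open>n\<close> covers the times up to \<open>n + 1\<close>, so that
    already stage 0 has an interval of positive length, as the extension step demands.\<close>
  define P where "P n s = (case s of (\<sigma>, E, I) \<Rightarrow> evolution {1..k} F 0 (real (Suc n)) \<sigma> E I \<and>
     (\<forall>u\<in>{0..real (Suc n)}. norm (E u (I (z (real (Suc n)))) - z u) < r))" for n s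
  define Q where "Q n s s' = (case (s, s') of ((\<sigma>, E, I), (\<sigma>', E', I')) \<Rightarrow>
     (\<forall>u<real (Suc n). \<sigma>' u = \<sigma> u) \<and> (\<forall>u\<le>real (Suc n). E' u = E u))"
    for n and s s' :: "(real \<Rightarrow> nat) \<times> (real \<Rightarrow> real ^ 'n \<Rightarrow> real ^ 'n) \<times> (real ^ 'n \<Rightarrow> real ^ 'n)"
  have "\<exists>s. \<forall>n. P n (s n) \<and> Q n (s n) (s (Suc n))"
  proof (rule dependent_nat_choice)
    obtain \<sigma> E I where "evolution {1..k} F 0 1 \<sigma> E I"
      "\<And>u. u \<in> {0..1} \<Longrightarrow> norm (E u (I (z 1)) - z u) < r"
      using shadow[OF z, of 0 1 r] r by auto
    then show "\<exists>s. P 0 s" by (intro exI[of _ "(\<sigma>, E, I)"]) (simp add: P_def)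
  next
    fix s n assume P: "P n s"
    obtain \<sigma> E I where s: "s = (\<sigma>, E, I)" by (cases s)
    have ev: "evolution {1..k} F 0 (real (Suc n)) \<sigma> E I"
      and close: "\<And>u. u \<in> {0..real (Suc n)} \<Longrightarrow> norm (E u (I (z (real (Suc n)))) - z u) < r"
      using P unfolding P_def s by auto
    obtain \<sigma>' E' I' where "evolution {1..k} F 0 (real (Suc n) + 1) \<sigma>' E' I'"
    "\<And>u. u \<in> {0..real (Suc n) + 1} \<Longrightarrow> norm (E' u (I' (z (real (Suc n) + 1))) - z u) < r"
    "\<And>u. u < real (Suc n) \<Longrightarrow> \<sigma>' u = \<sigma> u" "\<And>u. u \<le> real (Suc n) \<Longrightarrow> E' u = E u"
      by (rule shadow_extend[OF z _ ev close r]) auto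
    moreover have "real (Suc (Suc n)) = real (Suc n) + 1" by simp
    ultimately have "P (Suc n) (\<sigma>', E', I') \<and> Q n s (\<sigma>', E', I')"
      unfolding P_def Q_def s by (simp only: prod.case) blast
    then show "\<exists>s'. P (Suc n) s' \<and> Q n s s'" by blast
  qed
  then obtain s where s: "\<And>n. P n (s n)" "\<And>n. Q n (s n) (s (Suc n))" by blast
  define \<sigma> where "\<sigma> n = fst (s n)" for n
  define E where "E n = fst (snd (s n))" for n
  define I where "I n = snd (snd (s n))" for n
  have sn: "s n = (\<sigma> n, E n, I n)" for n by (simp add: \<sigma>_def E_def I_def)
  have ev: "evolution {1..k} F 0 (real (Suc n)) (\<sigma> n) (E n) (I n)" for n
    using s(1)[of n] unfolding sn P_def by simp
  have close: "norm (E n u (I n (z (real (Suc n)))) - z u) < r" if "0 \<le> u" "u \<le> real (Suc n)" for n u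
    using s(1)[of n] that unfolding sn P_def by simp
  have step: "u < real (Suc n) \<Longrightarrow> \<sigma> (Suc n) u = \<sigma> n u" "u \<le> real (Suc n) \<Longrightarrow> E (Suc n) u = E n u" for n u
    using s(2)[of n] unfolding sn Q_def by simp_all
  have \<sigma>_mono: "\<sigma> m u = \<sigma> n u" if "n \<le> m" "u < real (Suc n)" for m n u
    using that by (induction rule: dec_induct) (auto simp: step(1))
  have E_mono: "E m u = E n u" if "n \<le> m" "u \<le> real (Suc n)" for m n u
    using that by (induction rule: dec_induct) (auto simp: step(2))
  \<comment> \<open>A stage that covers \<open>u\<close> strictly: two stages share their signal
    only before the end of the shorter one.\<close>
  define N where "N u = nat \<lfloor>u\<rfloor>" for u :: real
  have N: "u < real (Suc (N u))" for u unfolding N_def by linarith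
  define p where "p n = I n (z (real (Suc n)))" for n
  have "norm (p n - z 0) \<le> r" for n
    using close[of 0 n] evolution_inverse(1)[OF ev[of n]] by (simp add: p_def)
  then have "\<forall>n. p n \<in> cball (z 0) r" by (simp add: dist_norm norm_minus_commute)
  moreover have "compact (cball (z 0) r)" by simp
  ultimately obtain x0 \<rho> where \<rho>: "strict_mono \<rho>" "(p \<circ> \<rho>) \<longlonglongrightarrow> x0"
    unfolding compact_def by blast
  define \<tau> where "\<tau> u = \<sigma> (N u) u" for u
  define x where "x u = E (N u) u x0" for u
  have \<tau>: "\<tau> u = \<sigma> n u" if "u < real (Suc n)" for n u
    using \<sigma>_mono[of "N u" n u] \<sigma>_mono[of n "N u" u] N[of u] that unfolding \<tau>_def
    by (cases "N u \<le> n") auto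
  have x: "x u = E n u x0" if "u < real (Suc n)" for n u
    using E_mono[of "N u" n u] E_mono[of n "N u" u] N[of u] that unfolding x_def
    by (cases "N u \<le> n") auto
  have R: "follows_right F \<tau> x t" if "0 \<le> t" for t
    using evolution_follows(1)[OF ev[of "N t"], of t x0] that N[of t] \<tau> x
    by (subst follows_right_cong[of t "real (Suc (N t))" _ "\<sigma> (N t)" _ "\<lambda>u. E (N t) u x0"]) auto
  have L: "follows_left F \<tau> x t" if "0 < t" for t
    using evolution_follows(2)[OF ev[of "N t"], of t x0] that N[of t]
    by (subst follows_left_cong[of 0 t _ "\<sigma> (N t)" _ "\<lambda>u. E (N t) u x0"]) (auto intro!: \<tau> x)
  have sw: "switching_signal k \<tau>" "switched_solution F \<tau> \<infinity> x"
  proof -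
    have 1: "\<tau> t \<in> {1..k}" for t unfolding \<tau>_def by (rule evolution_follows(3)[OF ev])
    have 2: "\<forall>\<^sub>F u in at_right t. \<tau> u = \<tau> t" if "0 \<le> t" for t using R[OF that] by (simp add: follows_right_def)
    have 3: "\<exists>c. \<forall>\<^sub>F u in at_left t. \<tau> u = c" if "0 < t" for t using L[OF that] by (auto simp: follows_left_def)
    show "switching_signal k \<tau>" "switched_solution F \<tau> \<infinity> x"
      using switched_solutionI[of \<tau> k \<infinity> F x, OF 1 2 3 R L] by simp_all
  qed
  have "norm (x t - z t) \<le> r" if t: "0 \<le> t" for t
  proof -
    \<comment> \<open>The stage is fixed by \<open>t\<close>. Later stages have the same transition
      map at time \<open>t\<close>, so \<open>E n t\<close> sends the initial values
      \<open>p (\<rho> m)\<close> \<open>r\<close>-close to \<open>z t\<close>; continuity passes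
      this to the limit, with the strict inequality weakened.\<close>
    define n where "n = N t"
    have tn: "t < real (Suc n)" using N by (simp add: n_def)
    have "continuous_on UNIV (\<lambda>y. E n t y)"
      by (rule evolution_continuous_on[OF ev]) (use t tn in \<open>auto intro: continuous_intros\<close>)
    then have "(\<lambda>m. E n t ((p \<circ> \<rho>) m)) \<longlonglongrightarrow> E n t x0"
      using \<rho>(2) by (rule continuous_on_tendsto_compose) auto
    then have lim: "(\<lambda>m. E n t ((p \<circ> \<rho>) m) - z t) \<longlonglongrightarrow> x t - z t"
      unfolding x[OF tn] by (intro tendsto_intros)
    have "norm (E n t ((p \<circ> \<rho>) m) - z t) \<le> r" if "n \<le> m" for m
    proof -
      have nm: "n \<le> \<rho> m" using that seq_suble[OF \<rho>(1), of m] by simp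
      then have "E n t (p (\<rho> m)) = E (\<rho> m) t (p (\<rho> m))" using E_mono[OF nm, of t] tn by simp
      moreover have "real (Suc n) \<le> real (Suc (\<rho> m))" using nm by simp
      then have "t \<le> real (Suc (\<rho> m))" using tn by linarith
      ultimately show ?thesis using close[OF t, of "\<rho> m"] by (simp add: p_def)
    qed
    then have "\<forall>\<^sub>F m in sequentially. norm (E n t ((p \<circ> \<rho>) m) - z t) \<le> r"
      by (auto simp: eventually_sequentially)
    with lim show ?thesis by (intro Lim_norm_ubound[of sequentially]) auto
  qed
  then show thesis using that[OF sw] by blast
qed

text \<open>A shadow that converges to 0 brings \<open>z\<close> arbitrarily close to 0 at some
  time. Since the field is autonomous, stability applies to the solution restarted at that time and
  turns this single visit into convergence.\<close>

lemma attractive: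
  assumes z: "forward_solution G \<infinity> z"
  shows "(z \<longlongrightarrow> 0) at_top"
proof -
  have near: "\<exists>t\<ge>0. norm (z t) < r" if r: "0 < r" for r
  proof (rule ccontr)
    assume "\<not> (\<exists>t\<ge>0. norm (z t) < r)"
    then have far: "r \<le> norm (z t)" if "0 \<le> t" for t using that by auto
    obtain \<sigma> x where x: "switching_signal k \<sigma>" "switched_solution F \<sigma> \<infinity> x"
      "\<And>t. 0 \<le> t \<Longrightarrow> norm (x t - z t) \<le> r / 2"
      using shadow_forever[OF z, of "r / 2"] r by auto
    have "maximal_solution (switched_solution F \<sigma>) \<infinity> x" using x(2) by (auto simp: maximal_solution_def)
    then have "(x \<longlongrightarrow> 0) at_top"
      using switched[unfolded switched_GAS_def, THEN conjunct2, rule_format, OF x(1), of \<infinity> x "x 0"] by blast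
    then have "\<forall>\<^sub>F t in at_top. dist (x t) 0 < r / 2" using r by (intro tendstoD) auto
    then obtain t where t: "0 \<le> t" "norm (x t) < r / 2"
      unfolding eventually_at_top_linorder dist_norm by (metis diff_zero max.cobounded1 max.cobounded2)
    have "norm (z t) \<le> norm (x t) + norm (x t - z t)" using norm_triangle_ineq4[of "x t" "x t - z t"] by simp
    then show False using t x(3)[OF t(1)] far[OF t(1)] by linarith
  qed
  show ?thesis
  proof (rule topological_tendstoI)
    fix U :: "(real ^ 'n) set" assume U: "open U" "0 \<in> U"
    obtain V where V: "open V" "0 \<in> V"
      and stab: "\<And>T z t. forward_solution G T z \<Longrightarrow> z 0 \<in> V \<Longrightarrow> 0 \<le> t \<Longrightarrow> ereal t < T \<Longrightarrow> z t \<in> U"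
      using stable[OF U] by metis
    obtain d where d: "0 < d" "ball 0 d \<subseteq> V" using V openE by blast
    obtain a where a: "0 \<le> a" "norm (z a) < d" using near[OF d(1)] by blast
    have "z (a + 0) \<in> V" using a(2) d(2) by auto
    then have "z (a + t) \<in> U" if "0 \<le> t" for t
      using stab[OF forward_solution_shift[OF z a(1)], of t] that by simp
    then have "z t \<in> U" if "a \<le> t" for t using that by (metis add_diff_cancel_left' diff_ge_0_iff_ge le_add_diff_inverse)
    then show "\<forall>\<^sub>F t in at_top. z t \<in> U" unfolding eventually_at_top_linorder by blast
  qed
qed

text \<open>After its last visit to a large ball the solution moves under \<open>F i\<close> only,
  hence along an \<open>F i\<close>-orbit starting in that compact ball; such orbits are uniformly
  bounded.\<close>

lemma solution_bounded:
  assumes R: "\<And>x. R \<le> norm x \<Longrightarrow> G x = F i x" and gas: "GAS (F i)"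
    and z: "forward_solution G T z"
  obtains M where "\<And>t. 0 \<le> t \<Longrightarrow> ereal t < T \<Longrightarrow> norm (z t) \<le> M"
proof -
  \<comment> \<open>Including \<open>norm (z 0)\<close> ensures that the set \<open>S\<close> of
    visits contains time 0.\<close>
  define R' where "R' = max R (norm (z 0))"
  obtain M where M: "\<And>t x. 0 \<le> t \<Longrightarrow> x \<in> cball 0 R' \<Longrightarrow> norm (\<phi> t x) \<le> M"
    using GAS_flow_bounded[OF flows(1) gas, of "cball 0 R'"] by auto
  have "norm (z t) \<le> max M R'" if t: "0 \<le> t" "ereal t < T" for t
  proof (cases "norm (z t) \<le> R'")
    case False
    have c: "continuous_on {0..t} z"
      using forward_solution_Icc[OF z order_refl t(2)] by (intro continuous_on_vector_derivative) auto
    define S where "S = {u \<in> {0..t}. norm (z u) \<le> R'}"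
    have "closed ({0..t} \<inter> (\<lambda>u. norm (z u)) -` {..R'})"
      using c by (intro continuous_closed_preimage continuous_on_norm) auto
    moreover have "{0..t} \<inter> (\<lambda>u. norm (z u)) -` {..R'} = S" by (auto simp: S_def)
    ultimately have "closed S" by simp
    moreover have "bounded S" by (rule bounded_subset[of "{0..t}"]) (auto simp: S_def)
    ultimately have "compact S" by (simp add: compact_eq_bounded_closed)
    moreover have "0 \<in> S" using t by (simp add: S_def R'_def)
    ultimately obtain \<tau> where \<tau>: "\<tau> \<in> S" "\<And>u. u \<in> S \<Longrightarrow> u \<le> \<tau>"
      using compact_attains_sup[of S] by blast
    have \<tau>t: "0 \<le> \<tau>" "\<tau> \<le> t" "norm (z \<tau>) \<le> R'" using \<tau>(1) by (auto simp: S_def)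
    \<comment> \<open>A crossing of the sphere of radius \<open>R'\<close> at or after the last
      visit is itself a visit, so it happens at \<open>\<tau>\<close>. Hence the norm is at least
      \<open>R'\<close> on the closed interval, including its left end.\<close>
    have "\<exists>u\<ge>\<tau>. u \<le> t \<and> norm (z u) = R'"
      using \<tau>t False c by (intro IVT') (auto intro!: continuous_intros elim: continuous_on_subset)
    then obtain u where u: "\<tau> \<le> u" "u \<le> t" "norm (z u) = R'" by blast
    then have "u = \<tau>" using \<tau>(2)[of u] \<tau>t(1) by (simp add: S_def)
    then have "R' \<le> norm (z u)" if "u \<in> {\<tau>..t}" for u
      using \<tau>(2)[of u] that \<tau>t(1) u(3) by (cases "norm (z u) \<le> R'") (auto simp: S_def)
    then have "R \<le> norm (z u)" if "u \<in> {\<tau>..t}" for u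
      using that by (fastforce simp: R'_def)
    then have "(z has_vector_derivative F i (z u)) (at u within {\<tau>..t})" if "u \<in> {\<tau>..t}" for u
      using forward_solution_Icc[OF z \<tau>t(1) t(2) that] R that by simp
    then have "z t = \<phi> (t - \<tau>) (z \<tau>)"
      by (rule locally_lipschitz_solution_unique[OF lipschitz(1), where y="\<lambda>u. \<phi> (u - \<tau>) (z \<tau>)" and a=\<tau> and b=t])
        (use \<tau>t flow_shift_deriv(1)[OF flows(1)] is_flow_ofD(2)[OF flows(1)] in auto)
    then show ?thesis using M[of "t - \<tau>" "z \<tau>"] \<tau>t by simp
  qed simp
  then show thesis using that by blast
qed

text \<open>Stability and attractivity come from shadowing; what remains is to exclude finite escape
  times, and there the solution is bounded and could be extended, against maximality.\<close>

lemma GAS_selection: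
  assumes R: "\<And>x. R \<le> norm x \<Longrightarrow> G x = F i x" and gas: "GAS (F i)" "GAS (F j)"
  shows "GAS G"
  unfolding GAS_def
proof (intro conjI allI impI)
  have "F i 0 = 0" "F j 0 = 0" using gas by (auto simp: GAS_def)
  then show "G 0 = 0" using selection[of 0] by auto
next
  fix U :: "(real ^ 'n) set" assume "open U \<and> 0 \<in> U"
  then show "\<exists>V. open V \<and> 0 \<in> V \<and> V \<subseteq> U \<and>
      (\<forall>T x. forward_solution G T x \<and> x 0 \<in> V \<longrightarrow> (\<forall>t\<ge>0. ereal t < T \<longrightarrow> x t \<in> U))"
    using stable[of U] by metis
next
  fix x0 T x assume "maximal_solution (forward_solution G) T x \<and> x 0 = x0"
  then have sol: "forward_solution G T x"
    and max: "\<not> (\<exists>T' y. T < T' \<and> forward_solution G T' y \<and> (\<forall>t\<ge>0. ereal t < T \<longrightarrow> y t = x t))"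
    by (auto simp: maximal_solution_def)
  show "T = \<infinity>"
  proof (cases T)
    case (real b)
    obtain M where M: "\<And>t. 0 \<le> t \<Longrightarrow> ereal t < T \<Longrightarrow> norm (x t) \<le> M"
      using solution_bounded[OF R gas(1) sol] by blast
    have "\<exists>T' y. ereal b < T' \<and> forward_solution G T' y \<and> (\<forall>t\<ge>0. ereal t < ereal b \<longrightarrow> y t = x t)"
      by (rule bounded_solution_extends[OF lipschitz(3)]) (use sol M real in auto)
    then show ?thesis using max real by blast
  qed (use sol in \<open>auto simp: forward_solution_def\<close>)
  then show "(x \<longlongrightarrow> 0) at_top" using sol by (intro attractive) simp
qed

end

section \<open>The path of vector fields\<close>

text \<open>For a subbasic set given by \<open>K\<close> and \<open>U\<close>, the bad parameters
  are the projection of the compact set of pairs in \<open>{0..1} \<times> K\<close> that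
  \<open>H\<close> maps outside \<open>U\<close>. The projection is compact, hence closed.\<close>

lemma pathin_compact_open:
  fixes H :: "real \<Rightarrow> 'a::metric_space \<Rightarrow> 'b::topological_space"
  assumes H: "continuous_on ({0..1} \<times> UNIV) (\<lambda>(s, x). H s x)"
  shows "pathin compact_open_topology H"
proof -
  have cont: "continuous_on UNIV (H s)" if "s \<in> {0..1}" for s
  proof -
    have "continuous_on UNIV (\<lambda>x::'a. (s, x))" by (intro continuous_intros)
    then have "continuous_on UNIV (\<lambda>x. case (s, x) of (s, x) \<Rightarrow> H s x)"
      by (rule continuous_on_compose2[OF H]) (use that in auto)
    then show ?thesis by simp
  qed
  show ?thesis
    unfolding pathin_def compact_open_topology_def
  proof (rule continuous_on_generated_topo)
    fix W :: "('a \<Rightarrow> 'b) set"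
    assume "W \<in> {{f. continuous_on UNIV f \<and> f ` K \<subseteq> U} | K U. compact K \<and> open U}"
    then obtain K U where W: "W = {f. continuous_on UNIV f \<and> f ` K \<subseteq> U}" and KU: "compact K" "open U" by auto
    define C where "C = {p \<in> {0..1} \<times> K. (\<lambda>(s, x). H s x) p \<in> - U}"
    have HK: "continuous_on ({0..1} \<times> K) (\<lambda>(s, x). H s x)"
      using H by (rule continuous_on_subset) auto
    have "closedin (top_of_set ({0..1} \<times> K)) (({0..1} \<times> K) \<inter> (\<lambda>(s, x). H s x) -` (- U))"
      using HK KU(2) by (intro continuous_closedin_preimage) (auto simp: closed_Compl)
    moreover have "({0..1} \<times> K) \<inter> (\<lambda>(s, x). H s x) -` (- U) = C" unfolding C_def by auto
    ultimately have "compact C"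
      using closedin_compact[of "{0..1} \<times> K" C] compact_Times[of "{0..1::real}" K] KU(1) by auto
    then have "compact (fst ` C)"
      by (intro compact_continuous_image continuous_on_fst continuous_on_id)
    then have "closed (fst ` C)" by (rule compact_imp_closed)
    then have "openin (top_of_set {0..1}) ({0..1} \<inter> - (fst ` C))" by (intro openin_open_Int) auto
    moreover have "H -` W \<inter> {0..1} = {0..1} \<inter> - (fst ` C)"
    proof (intro set_eqI iffI)
      fix s assume "s \<in> H -` W \<inter> {0..1}"
      then show "s \<in> {0..1} \<inter> - (fst ` C)" unfolding W C_def by force
    next
      fix s assume s: "s \<in> {0..1} \<inter> - (fst ` C)"
      then have "H s x \<in> U" if "x \<in> K" for x
        using that unfolding C_def by (force simp: image_iff)
      then show "s \<in> H -` W \<inter> {0..1}" using s cont unfolding W by auto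
    qed
    ultimately show "openin (top_of_set {0..1}) (H -` W \<inter> topspace (top_of_set {0..1}))" by simp
  next
    show "H ` topspace (top_of_set {0..1}) \<subseteq> \<Union> {{f. continuous_on UNIV f \<and> f ` K \<subseteq> U} | K U. compact K \<and> open U}"
      using cont topspace_compact_open_topology[where 'a='a and 'b='b]
      unfolding compact_open_topology_def topology_generated_by_topspace by auto
  qed
qed

text \<open>The field is \<open>A\<close> plus \<open>c\<close> times the difference
  \<open>B - A\<close>, which is Lipschitz and bounded on a unit ball; the product rule for
  Lipschitz functions then gives the constant.\<close>

lemma locally_lipschitz_interpolation:
  fixes A B :: "real ^ 'n \<Rightarrow> real ^ 'n"
  assumes A: "locally_lipschitz A" and B: "locally_lipschitz B"
    and c: "\<And>x y. \<bar>c x - c y\<bar> \<le> norm (x - y)" "\<And>x. \<bar>c x\<bar> \<le> 1"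
  shows "locally_lipschitz (\<lambda>x. (1 - c x) *\<^sub>R A x + c x *\<^sub>R B x)"
proof (rule locally_lipschitzI)
  fix x0 :: "real ^ 'n"
  let ?K = "cball x0 1" and ?D = "\<lambda>x. B x - A x"
  obtain LA where LA: "LA-lipschitz_on ?K A" by (rule locally_lipschitz_on_compact[OF A compact_cball])
  obtain LB where LB: "LB-lipschitz_on ?K B" by (rule locally_lipschitz_on_compact[OF B compact_cball])
  have LD: "(LB + LA)-lipschitz_on ?K ?D" by (rule lipschitz_on_diff[OF LB LA])
  have "compact (?D ` ?K)"
    by (intro compact_continuous_image continuous_intros locally_lipschitz_continuous_on A B) auto
  then have "bounded (?D ` ?K)" by (rule compact_imp_bounded)
  then obtain M where M: "0 < M" "\<forall>y\<in>?D ` ?K. norm y \<le> M" unfolding bounded_pos by blast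
  have nn: "0 \<le> LA" "0 \<le> LB + LA" using LA LD by (auto intro: lipschitz_on_nonneg)
  have "(LA + (M + (LB + LA)))-lipschitz_on ?K (\<lambda>x. (1 - c x) *\<^sub>R A x + c x *\<^sub>R B x)"
  proof (rule lipschitz_onI)
    fix x y assume xy: "x \<in> ?K" "y \<in> ?K"
    have "((1 - c x) *\<^sub>R A x + c x *\<^sub>R B x) - ((1 - c y) *\<^sub>R A y + c y *\<^sub>R B y)
      = (A x - A y) + ((c x - c y) *\<^sub>R ?D x + c y *\<^sub>R (?D x - ?D y))"
      by (simp add: algebra_simps)
    also have "norm \<dots> \<le> norm (A x - A y) + (norm ((c x - c y) *\<^sub>R ?D x) + norm (c y *\<^sub>R (?D x - ?D y)))"
      by (intro norm_triangle_le add_mono order_refl)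
    also have "\<dots> \<le> LA * norm (x - y) + (norm (x - y) * M + 1 * ((LB + LA) * norm (x - y)))"
    proof (intro add_mono)
      show "norm (A x - A y) \<le> LA * norm (x - y)" using lipschitz_onD[OF LA xy] by (simp add: dist_norm)
      show "norm ((c x - c y) *\<^sub>R ?D x) \<le> norm (x - y) * M"
        using c(1)[of x y] M xy(1) by (simp add: mult_mono)
      have "norm (?D x - ?D y) \<le> (LB + LA) * norm (x - y)" using lipschitz_onD[OF LD xy] by (simp add: dist_norm)
      then show "norm (c y *\<^sub>R (?D x - ?D y)) \<le> 1 * ((LB + LA) * norm (x - y))"
        unfolding norm_scaleR using c(2)[of y] by (intro mult_mono) auto
    qed
    finally show "dist ((1 - c x) *\<^sub>R A x + c x *\<^sub>R B x) ((1 - c y) *\<^sub>R A y + c y *\<^sub>R B y)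
      \<le> (LA + (M + (LB + LA))) * dist x y"
      by (simp add: dist_norm algebra_simps)
  qed (use nn M in auto)
  then show "\<exists>L. L-lipschitz_on ?K (\<lambda>x. (1 - c x) *\<^sub>R A x + c x *\<^sub>R B x)" by blast
qed

theorem mainTheorem7:
  fixes k :: nat and F :: "nat \<Rightarrow> real ^ 'n \<Rightarrow> real ^ 'n"
  assumes "\<forall>i\<in>{1..k}. locally_lipschitz (F i)"
    and "\<forall>i\<in>{1..k}. complete_vector_field (F i)"
    and "\<forall>i\<in>{1..k}. GAS (F i)"
    and "switched_GAS k F"
  shows "\<forall>i\<in>{1..k}. \<forall>j\<in>{1..k}. path_component_of GAS_vector_fields (F i) (F j)"
proof (intro ballI)
  fix i j assume i: "i \<in> {1..k}" and j: "j \<in> {1..k}"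
  \<comment> \<open>The weight is identically 0 for \<open>s = 0\<close> and identically 1 for
    \<open>s = 1\<close>; in between it vanishes as soon as \<open>norm x\<close> reaches
    \<open>s / (1 - s)\<close>.\<close>
  define c where "c s x = max 0 (s - (1 - s) * norm x)" for s :: real and x :: "real ^ 'n"
  define H where "H s x = (1 - c s x) *\<^sub>R F i x + c s x *\<^sub>R F j x" for s x
  have c01: "c s x \<in> {0..1}" if "s \<in> {0..1}" for s x
    using that by (auto simp: c_def) (smt (verit) mult_nonneg_nonneg norm_ge_zero)
  have ends: "H 0 = F i" "H 1 = F j" by (auto simp: H_def c_def fun_eq_iff)
  have "GAS (H s)" if s: "s \<in> {0..1}" for s
  \<comment> \<open>At \<open>s = 1\<close> the weight has unbounded support and the boundedness
    argument does not apply, but the field is \<open>F j\<close> itself.\<close>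
  proof (cases "s = 1")
    case True
    then show ?thesis using assms(3) j ends by simp
  next
    case False
    then have s1: "0 \<le> s" "s < 1" using s by auto
    obtain \<phi> \<psi> where fl: "is_flow_of (F i) \<phi>" "is_flow_of (F j) \<psi>"
      using assms(2) i j unfolding complete_vector_field_def by blast
    have lip: "\<bar>c s x - c s y\<bar> \<le> norm (x - y)" for x y
    proof -
      have "\<bar>c s x - c s y\<bar> \<le> \<bar>(1 - s) * (norm x - norm y)\<bar>" unfolding c_def by (simp add: algebra_simps max_def abs_if)
      also have "\<dots> = (1 - s) * \<bar>norm x - norm y\<bar>" using s1 by (simp add: abs_mult)
      also have "\<dots> \<le> 1 * norm (x - y)" using s1 by (intro mult_mono norm_triangle_ineq3) auto
      finally show ?thesis by simp
    qed
    have "\<bar>c s x\<bar> \<le> 1" for x using c01[OF s, of x] by auto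
    then have "locally_lipschitz (H s)"
      unfolding H_def using assms(1) i j lip by (intro locally_lipschitz_interpolation) auto
    then interpret convex_selection k F i j \<phi> \<psi> "H s"
      using i j fl assms c01[OF s] by unfold_locales (auto simp: H_def)
    show ?thesis
    proof (rule GAS_selection)
      show "H s x = F i x" if "s / (1 - s) \<le> norm x" for x
        using that s1 by (simp add: H_def c_def field_simps)
    qed (use assms(3) i j in auto)
  qed
  moreover have "continuous_on ({0..1} \<times> UNIV) (\<lambda>(s, x). H s x)"
  proof -
    have Fc: "continuous_on ({0..1::real} \<times> UNIV) (\<lambda>p. F l (snd p))" if "l \<in> {1..k}" for l
      using that assms(1)
      by (intro continuous_on_compose2[OF locally_lipschitz_continuous_on[of "F l" UNIV]] continuous_on_snd continuous_on_id) auto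
    show ?thesis unfolding H_def c_def split_def
      using Fc[OF i] Fc[OF j] by (intro continuous_intros)
  qed
  then have "pathin compact_open_topology H" by (rule pathin_compact_open)
  ultimately have "pathin GAS_vector_fields H"
    unfolding GAS_vector_fields_def pathin_subtopology by auto
  then show "path_component_of GAS_vector_fields (F i) (F j)"
    unfolding path_component_of_def using ends by blast
qed

end
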